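(* Let $0<q<1$, $n\ge1$, let $\lambda=(\lambda_1,\dots,\lambda_n)$, $\mu=(\mu_1,\dots,\mu_n)$ be partitions with at most $n$ parts, let $\nu=(n+\lambda_1,\dots,n+\lambda_n,\mu'_1,\mu'_2,\dots)$ and let $a\ge0$ be real. Then \[ \sum_{T\in\mathrm{RPP}(\nu)}q^{|T|}(q^a)^{\mathrm{tr}(T)}=\frac{q^{(1-a)\binom n2-b(\delta_{n+1}+\lambda)-b(\delta_{n+1}+\mu)}}{\prod_{j=1}^n(q;q)_{\lambda_j+n-j}(q;q)_{\mu_j+n-j}}\cdot\frac{1}{(1-q)^n}\int_{0\le x_1\le\cdots\le x_n\le1}s_\lambda(x)s_\mu(x)\prod_{i=1}^n x_i^a\,\overline\Delta(x)^2\,d_qx_1\cdots d_qx_n. \]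
   Context: $\nu$ is the square $(n^n)$ with $\lambda$ attached on the right and $\mu'$ (conjugate of $\mu$) attached below. A reverse plane partition of shape $\nu$ is a filling of $\{(i,j):1\le j\le\nu_i\}$ by nonnegative integers weakly increasing along rows and down columns; $|T|$ is the sum of entries and $\mathrm{tr}(T)=\sum_{i=1}^nT(i,i)$. $\delta_{n+1}=(n,\dots,1)$, $b(\kappa)=\sum_i(i-1)\kappa_i$. $s_\lambda$ is the Schur polynomial in $x=(x_1,\dots,x_n)$, $\overline\Delta(x)=\prod_{i<j}(x_j-x_i)$, $(q;q)_k=\prod_{l=1}^k(1-q^l)$. For $0<q<1$, $\int_a^b g\,d_qx=(1-q)\sum_{i\ge0}(g(bq^i)bq^i-g(aq^i)aq^i)$, and the integral over $\{0\le x_1\le\cdots\le x_n\le1\}$ is $\int_0^1\int_0^{x_n}\cdots\int_0^{x_2}(\cdot)\,d_qx_1\cdots d_qx_n$. *)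

theory Defs
  imports "HOL-Analysis.Analysis"
begin

text \<open>
  Partitions are functions on the natural numbers, indexed from 1 as in
  \<open>\<lambda> = (\<lambda>\<^sub>1, \<lambda>\<^sub>2, \<dots>)\<close> and eventually 0; the value at index 0 carries no meaning.
  Likewise the variables \<open>x = (x\<^sub>1, \<dots>, x\<^sub>n)\<close> are the values at \<open>1, \<dots>, n\<close> of a function.
\<close>

definition partition_parts_le :: "nat \<Rightarrow> (nat \<Rightarrow> nat) \<Rightarrow> bool" where
  "partition_parts_le n \<kappa> \<longleftrightarrow> (\<forall>i\<ge>1. \<kappa> (Suc i) \<le> \<kappa> i) \<and> (\<forall>i>n. \<kappa> i = 0)"

definition conjugate :: "(nat \<Rightarrow> nat) \<Rightarrow> nat \<Rightarrow> nat" where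
  "conjugate \<kappa> j = card {i. 1 \<le> i \<and> j \<le> \<kappa> i}"

definition young_diagram :: "(nat \<Rightarrow> nat) \<Rightarrow> (nat \<times> nat) set" where
  "young_diagram \<kappa> = {(i, j). 1 \<le> i \<and> 1 \<le> j \<and> j \<le> \<kappa> i}"

definition attached_shape :: "nat \<Rightarrow> (nat \<Rightarrow> nat) \<Rightarrow> (nat \<Rightarrow> nat) \<Rightarrow> nat \<Rightarrow> nat" where
  "attached_shape n \<kappa> \<mu> i = (if i \<le> n then n + \<kappa> i else conjugate \<mu> (i - n))"

definition staircase :: "nat \<Rightarrow> nat \<Rightarrow> nat" where
  "staircase m i = m - i"

definition b_stat :: "(nat \<Rightarrow> nat) \<Rightarrow> nat" where
  "b_stat \<kappa> = (\<Sum>i | 1 \<le> i \<and> \<kappa> i \<noteq> 0. (i - 1) * \<kappa> i)"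

text \<open>
  A filling is a total function. Setting it to 0 outside the diagram makes it determined
  by its entries in the diagram, so that sums over fillings count each of them once.
\<close>

definition RPP :: "(nat \<Rightarrow> nat) \<Rightarrow> (nat \<Rightarrow> nat \<Rightarrow> nat) set" where
  "RPP \<kappa> = {T.
     (\<forall>i j. (i, j) \<notin> young_diagram \<kappa> \<longrightarrow> T i j = 0) \<and>
     (\<forall>i j j'. (i, j) \<in> young_diagram \<kappa> \<and> (i, j') \<in> young_diagram \<kappa> \<and> j \<le> j'
        \<longrightarrow> T i j \<le> T i j') \<and>
     (\<forall>i i' j. (i, j) \<in> young_diagram \<kappa> \<and> (i', j) \<in> young_diagram \<kappa> \<and> i \<le> i'
        \<longrightarrow> T i j \<le> T i' j)}"

definition rpp_size :: "(nat \<Rightarrow> nat) \<Rightarrow> (nat \<Rightarrow> nat \<Rightarrow> nat) \<Rightarrow> nat" where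
  "rpp_size \<kappa> T = (\<Sum>(i, j)\<in>young_diagram \<kappa>. T i j)"

definition rpp_trace :: "nat \<Rightarrow> (nat \<Rightarrow> nat \<Rightarrow> nat) \<Rightarrow> nat" where
  "rpp_trace n T = (\<Sum>i=1..n. T i i)"

definition SSYT :: "nat \<Rightarrow> (nat \<Rightarrow> nat) \<Rightarrow> (nat \<Rightarrow> nat \<Rightarrow> nat) set" where
  "SSYT n \<kappa> = {T.
     (\<forall>i j. (i, j) \<notin> young_diagram \<kappa> \<longrightarrow> T i j = 0) \<and>
     (\<forall>i j. (i, j) \<in> young_diagram \<kappa> \<longrightarrow> T i j \<in> {1..n}) \<and>
     (\<forall>i j j'. (i, j) \<in> young_diagram \<kappa> \<and> (i, j') \<in> young_diagram \<kappa> \<and> j \<le> j'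
        \<longrightarrow> T i j \<le> T i j') \<and>
     (\<forall>i i' j. (i, j) \<in> young_diagram \<kappa> \<and> (i', j) \<in> young_diagram \<kappa> \<and> i < i'
        \<longrightarrow> T i j < T i' j)}"

text \<open>
  The combinatorial definition of the Schur polynomial. The quotient of alternants would
  involve a division by zero at points with coinciding coordinates.
\<close>

definition schur :: "nat \<Rightarrow> (nat \<Rightarrow> nat) \<Rightarrow> (nat \<Rightarrow> real) \<Rightarrow> real" where
  "schur n \<kappa> x = (\<Sum>T\<in>SSYT n \<kappa>. \<Prod>(i, j)\<in>young_diagram \<kappa>. x (T i j))"

definition vandermonde :: "nat \<Rightarrow> (nat \<Rightarrow> real) \<Rightarrow> real" where
  "vandermonde n x = (\<Prod>j=1..n. \<Prod>i=1..<j. x j - x i)"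

definition qq_poch :: "real \<Rightarrow> nat \<Rightarrow> real" where
  "qq_poch q k = (\<Prod>l=1..k. 1 - q ^ l)"

definition q_integral :: "real \<Rightarrow> real \<Rightarrow> real \<Rightarrow> (real \<Rightarrow> real) \<Rightarrow> real" where
  "q_integral q a b g =
     (1 - q) * (\<Sum>i. g (b * q ^ i) * (b * q ^ i) - g (a * q ^ i) * (a * q ^ i))"

text \<open>
  \<open>simplex_q_integral q n c f\<close> is the iterated q-integral of \<open>f\<close> over
  \<open>0 \<le> x\<^sub>1 \<le> \<dots> \<le> x\<^sub>n \<le> c\<close>: the outermost integration is that of \<open>x\<^sub>n\<close> from 0 to \<open>c\<close>, and
  its value \<open>t\<close> is the upper limit for \<open>x\<^sub>n\<^sub>-\<^sub>1\<close>. The initial point \<open>\<lambda>_. 0\<close> is overwritten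
  at the indices \<open>1, \<dots>, n\<close>.
\<close>

fun simplex_q_integral :: "real \<Rightarrow> nat \<Rightarrow> real \<Rightarrow> ((nat \<Rightarrow> real) \<Rightarrow> real) \<Rightarrow> real" where
  "simplex_q_integral q 0 c f = f (\<lambda>_. 0)"
| "simplex_q_integral q (Suc m) c f =
     q_integral q 0 c (\<lambda>t. simplex_q_integral q m t (\<lambda>x. f (x(Suc m := t))))"

end

theory Submission
  imports Defs "Jordan_Normal_Form.Determinant"
begin

text \<open>
  A reverse plane partition of shape \<open>\<nu>\<close> consists of its diagonal \<open>d\<^sub>1 \<le> \<dots> \<le> d\<^sub>n\<close> and two
  independent halves, the one above it having \<open>L\<^sub>i = \<lambda>\<^sub>i + n - i\<close> cells in row \<open>i\<close>, the one below it
  \<open>\<mu>\<^sub>i + n - i\<close> cells in column \<open>i\<close>. With \<open>y\<^sub>j = q\<close> to the power \<open>d\<^sub>j + j - 1\<close>, the generating function of a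
  half is, up to a constant, the alternant \<open>det (y\<^sub>j\<close> to the power \<open>L\<^sub>i)\<close>: stripping off
  the diagonal leaves a half with smaller \<open>L\<close> whose new diagonal interlaces with \<open>d\<close>, so that the
  summation variables are independent and the sum can be taken inside the determinant,
  where geometric series turn it into differences of adjacent columns. The same column operation
  gives the bialternant formula for Schur polynomials, the branching rule taking the place of the
  stripping. Hence the two halves contribute the integrand at the points \<open>x\<^sub>i = y\<^sub>n\<^sub>+\<^sub>1\<^sub>-\<^sub>i\<close>, and these are
  exactly the nodes of the iterated q-integral at which the Vandermonde product does not vanish.
\<close>

section \<open>Sums over product sets and determinants\<close>

text \<open>The default 0 outside \<open>A\<close>, in place of the \<open>undefined\<close> of
  \<open>PiE\<close>, agrees with the convention for partitions and diagonals, so that these are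
  elements of such sets as they stand.\<close>

definition zero_PiE :: "nat set \<Rightarrow> (nat \<Rightarrow> nat set) \<Rightarrow> (nat \<Rightarrow> nat) set" where
  "zero_PiE A S = {f. (\<forall>i\<in>A. f i \<in> S i) \<and> (\<forall>i. i \<notin> A \<longrightarrow> f i = 0)}"

text \<open>Summability of real families is absolute. The iterated sum of the absolute values is
  therefore finite, which gives summability on the product set.\<close>

lemma has_sum_mult_Times:
  fixes f :: "'a \<Rightarrow> real" and g :: "'b \<Rightarrow> real"
  assumes f: "(f has_sum s) A" and g: "(g has_sum t) B"
  shows "((\<lambda>(x, y). f x * g y) has_sum (s * t)) (A \<times> B)"
proof (rule has_sum_SigmaI)
  have "(\<lambda>x. \<bar>f x\<bar>) summable_on A" "(\<lambda>y. \<bar>g y\<bar>) summable_on B"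
    using f g summable_on_iff_abs_summable_on_real by (auto simp: summable_on_def)
  then have "(\<lambda>(x, y). \<bar>f x\<bar> * \<bar>g y\<bar>) summable_on (A \<times> B)"
    by (intro summable_on_SigmaI[where g = "\<lambda>x. \<bar>f x\<bar> * infsum (\<lambda>y. \<bar>g y\<bar>) B"])
       (auto intro!: has_sum_cmult_right summable_on_cmult_left)
  then show "(\<lambda>(x, y). f x * g y) summable_on (A \<times> B)"
    by (subst summable_on_iff_abs_summable_on_real) (simp add: case_prod_unfold abs_mult)
qed (use f g in \<open>auto intro: has_sum_cmult_right has_sum_cmult_left\<close>)

lemma has_sum_prod_zero_PiE:
  fixes g :: "nat \<Rightarrow> nat \<Rightarrow> real"
  assumes "finite A" and "\<And>i. i \<in> A \<Longrightarrow> (g i has_sum h i) (S i)"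
  shows "((\<lambda>f. \<Prod>i\<in>A. g i (f i)) has_sum (\<Prod>i\<in>A. h i)) (zero_PiE A S)"
  using assms
proof (induction A)
  case empty
  have "zero_PiE {} S = {\<lambda>_. 0}"
    by (auto simp: zero_PiE_def)
  then show ?case
    using has_sum_finite[of "{\<lambda>_. 0 :: nat}" "\<lambda>f. \<Prod>i\<in>{}. g i (f i)"] by simp
next
  case (insert a A)
  let ?g = "\<lambda>(f, k). (\<Prod>i\<in>A. g i (f i)) * g a k"
  have IH: "((\<lambda>f. \<Prod>i\<in>A. g i (f i)) has_sum (\<Prod>i\<in>A. h i)) (zero_PiE A S)"
    using insert by auto
  have ga: "(g a has_sum h a) (S a)"
    using insert by auto
  have "(?g has_sum ((\<Prod>i\<in>A. h i) * h a)) (zero_PiE A S \<times> S a)"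
    using IH ga by (rule has_sum_mult_Times)
  then have "((\<lambda>f. \<Prod>i\<in>insert a A. g i (f i)) has_sum ((\<Prod>i\<in>A. h i) * h a)) (zero_PiE (insert a A) S)"
    by (subst has_sum_reindex_bij_witness[where T="zero_PiE A S \<times> S a" and h="?g"
          and j="\<lambda>f. (f(a := 0), f a)" and i="\<lambda>(f, k). f(a := k)"])
       (use insert in \<open>auto simp: zero_PiE_def fun_upd_def mult.commute intro!: ext prod.cong\<close>)
  then show ?case
    using insert by (simp add: mult.commute)
qed

lemma has_sum_finite_sum:
  fixes f :: "'i \<Rightarrow> 'a \<Rightarrow> 'b :: topological_comm_monoid_add"
  assumes "finite I" and "\<And>i. i \<in> I \<Longrightarrow> (f i has_sum s i) A"
  shows "((\<lambda>x. \<Sum>i\<in>I. f i x) has_sum (\<Sum>i\<in>I. s i)) A"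
  using assms by (induction I) (auto intro: has_sum_add)

section \<open>Determinants with rows and columns numbered from 1\<close>

definition det1 :: "nat \<Rightarrow> (nat \<Rightarrow> nat \<Rightarrow> real) \<Rightarrow> real" where
  "det1 m F = Determinant.det (mat m m (\<lambda>(i, j). F (Suc i) (Suc j)))"

lemma det1_cong:
  assumes "\<And>i j. i \<in> {1..m} \<Longrightarrow> j \<in> {1..m} \<Longrightarrow> F i j = G i j"
  shows "det1 m F = det1 m G"
  unfolding det1_def by (rule arg_cong[where f=Determinant.det]) (auto simp: assms)

lemma det1_0 [simp]: "det1 0 F = 1"
  by (simp add: det1_def)

lemma det1_transpose: "det1 m (\<lambda>i j. F j i) = det1 m F"
proof -
  have "mat m m (\<lambda>(i, j). F (Suc j) (Suc i)) = transpose_mat (mat m m (\<lambda>(i, j). F (Suc i) (Suc j)))"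
    by auto
  then show ?thesis
    unfolding det1_def by (metis det_transpose mat_carrier)
qed

text \<open>The Leibniz expansion, arranged with one factor per column \<open>j\<close>, so that a
  variable attached to a column occurs in one factor only. The permutations act on indices from 0,
  hence the shifts.\<close>

lemma det1_columns:
  "det1 m F = (\<Sum>p | p permutes {0..<m}. signof p * (\<Prod>j=1..m. F (Suc (p (j - 1))) j))"
proof -
  have "(\<Prod>j=0..<m. F (Suc (p j)) (Suc j)) = (\<Prod>j=1..m. F (Suc (p (j - 1))) j)" for p
    by (rule prod.reindex_bij_witness[where i="\<lambda>j. j - 1" and j=Suc]) auto
  moreover have "det1 m F = (\<Sum>p | p permutes {0..<m}. signof p * (\<Prod>j=0..<m. F (Suc (p j)) (Suc j)))"
    unfolding det1_transpose[of m F, symmetric] unfolding det1_def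
    by (subst det_def'[of _ m]) (auto intro!: sum.cong prod.cong simp: permutes_in_image[of _ "{0..<m}", simplified])
  ultimately show ?thesis by simp
qed

text \<open>Column \<open>j\<close> depends on \<open>f j\<close> alone. Each term of the Leibniz
  expansion is thus a product over independent variables, and the summation passes into the
  entries.\<close>

lemma has_sum_det1:
  assumes "\<And>i j. i \<in> {1..m} \<Longrightarrow> j \<in> {1..m} \<Longrightarrow> (g i j has_sum h i j) (S j)"
  shows "((\<lambda>f. det1 m (\<lambda>i j. g i j (f j))) has_sum det1 m h) (zero_PiE {1..m} S)"
  unfolding det1_columns
proof (intro has_sum_finite_sum has_sum_cmult_right)
  fix p assume p: "p \<in> {p. p permutes {0..<m}}"
  show "((\<lambda>f. \<Prod>j=1..m. g (Suc (p (j - 1))) j (f j)) has_sum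
      (\<Prod>j=1..m. h (Suc (p (j - 1))) j)) (zero_PiE {1..m} S)"
  proof (rule has_sum_prod_zero_PiE)
    fix j assume "j \<in> {1..m}"
    with p have "p (j - 1) < m"
      by (auto simp: permutes_in_image[of _ "{0..<m}", simplified])
    then show "(g (Suc (p (j - 1))) j has_sum h (Suc (p (j - 1))) j) (S j)"
      using \<open>j \<in> {1..m}\<close> by (intro assms) auto
  qed simp
qed (simp add: finite_permutations)

lemma det1_scale:
  "det1 m (\<lambda>i j. r i * s j * F i j) = (\<Prod>i=1..m. r i) * (\<Prod>j=1..m. s j) * det1 m F"
proof -
  have "(\<Prod>j=1..m. r (Suc (p (j - 1)))) = (\<Prod>i=1..m. r i)" if "p permutes {0..<m}" for p
  proof -
    have "(\<Prod>j=1..m. r (Suc (p (j - 1)))) = (\<Prod>j\<in>{0..<m}. r (Suc (p j)))"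
      by (rule prod.reindex_bij_witness[where j="\<lambda>j. j - 1" and i=Suc]) auto
    also have "\<dots> = (\<Prod>j\<in>{0..<m}. r (Suc j))"
      using prod.permute[OF that, of "\<lambda>j. r (Suc j)"] by (simp add: o_def)
    also have "\<dots> = (\<Prod>i=1..m. r i)"
      by (rule prod.reindex_bij_witness[where i="\<lambda>j. j - 1" and j=Suc]) auto
    finally show ?thesis .
  qed
  then show ?thesis
    unfolding det1_columns
    by (auto simp: prod.distrib sum_distrib_left mult_ac intro!: sum.cong)
qed

text \<open>Right multiplication by a lower bidiagonal matrix with unit diagonal performs all the
  operations at once, each column being changed by the original column to its right.\<close>

lemma det1_col_ops:
  "det1 m (\<lambda>i j. if j < m then F i j - t j * F i (Suc j) else F i j) = det1 m F"
proof -
  let ?A = "mat m m (\<lambda>(i, j). F (Suc i) (Suc j))"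
  let ?B = "mat m m (\<lambda>(i, j). if i = j then 1 else if i = Suc j then - t (Suc j) else 0)"
  let ?C = "mat m m (\<lambda>(i, j). if Suc j < m then F (Suc i) (Suc j) - t (Suc j) * F (Suc i) (Suc (Suc j))
      else F (Suc i) (Suc j))"
  have "?C = ?A * ?B"
  proof (rule eq_matI)
    fix i j assume "i < dim_row (?A * ?B)" "j < dim_col (?A * ?B)"
    then have "i < m" "j < m" by auto
    have "(\<Sum>k=0..<m. F (Suc i) (Suc k) * (if k = j then 1 else if k = Suc j then - t (Suc j) else 0))
       = (\<Sum>k=0..<m. (if k = j then F (Suc i) (Suc k) else 0) +
           (if k = Suc j then - t (Suc j) * F (Suc i) (Suc k) else 0))"
      by (intro sum.cong) auto
    also have "\<dots> = F (Suc i) (Suc j) + (if Suc j < m then - t (Suc j) * F (Suc i) (Suc (Suc j)) else 0)"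
      using \<open>j < m\<close> by (simp add: sum.distrib)
    finally have *: "(\<Sum>k=0..<m. F (Suc i) (Suc k) * (if k = j then 1 else if k = Suc j then - t (Suc j) else 0)) = \<dots>" .
    show "?C $$ (i, j) = (?A * ?B) $$ (i, j)"
      using * \<open>i < m\<close> \<open>j < m\<close> by (simp add: scalar_prod_def)
  qed simp_all
  moreover have "Determinant.det ?B = 1"
    by (subst det_lower_triangular[of m]) (auto simp: prod_list_diag_prod)
  ultimately show ?thesis
    unfolding det1_def by (simp add: det_mult[of _ m])
qed

text \<open>Laplace expansion along the last row. Column operations produce such a row in the
  bialternant formula and for a half with empty last row.\<close>

lemma det1_last_row:
  assumes "\<And>j. j \<in> {1..m} \<Longrightarrow> F (Suc m) j = 0"
  shows "det1 (Suc m) F = F (Suc m) (Suc m) * det1 m F"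
proof -
  let ?A = "mat (Suc m) (Suc m) (\<lambda>(i, j). F (Suc i) (Suc j))"
  have "det1 (Suc m) F = (\<Sum>j<Suc m. ?A $$ (m, j) * cofactor ?A m j)"
    unfolding det1_def by (rule laplace_expansion_row) auto
  also have "\<dots> = ?A $$ (m, m) * cofactor ?A m m"
    using assms by (simp add: lessThan_Suc)
  also have "mat_delete ?A m m = mat m m (\<lambda>(i, j). F (Suc i) (Suc j))"
    by (rule eq_matI) (auto simp: mat_delete_def)
  then have "cofactor ?A m m = det1 m F"
    by (simp add: cofactor_def det1_def)
  finally show ?thesis by simp
qed

text \<open>The sign of the reversal is the same for all \<open>F\<close>. It will be applied to
  both factors of a product of two determinants, where only its square appears.\<close>

lemma det1_reverse_rows:
  "\<exists>s. s\<^sup>2 = 1 \<and> (\<forall>F. det1 m (\<lambda>i j. F (Suc m - i) j) = s * det1 m F)"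
proof -
  define p where "p = (\<lambda>i. if i < m then m - Suc i else i)"
  have p: "p permutes {0..<m}"
  proof (rule bij_imp_permutes)
    show "bij_betw p {0..<m} {0..<m}"
      by (rule bij_betw_byWitness[where f'=p]) (auto simp: p_def)
  qed (auto simp: p_def)
  show ?thesis
  proof (intro exI conjI allI)
    show "(signof p :: real)\<^sup>2 = 1"
      by (simp add: sign_def)
    fix F
    show "det1 m (\<lambda>i j. F (Suc m - i) j) = signof p * det1 m F"
      unfolding det1_def
      by (subst det_permute_rows[symmetric, OF _ p])
         (auto intro!: arg_cong[where f=Determinant.det] simp: p_def Suc_diff_Suc)
  qed
qed

text \<open>The Leibniz expansion has \<open>fact m\<close> terms, each at most 1 in absolute value.
  The bound makes the sum over all diagonals converge.\<close>

lemma abs_det1_le: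
  assumes "\<And>i j. i \<in> {1..m} \<Longrightarrow> j \<in> {1..m} \<Longrightarrow> \<bar>F i j\<bar> \<le> 1"
  shows "\<bar>det1 m F\<bar> \<le> fact m"
proof -
  have "\<bar>det1 m F\<bar> \<le> (\<Sum>p | p permutes {0..<m}. 1)"
    unfolding det1_columns
  proof (rule order_trans[OF sum_abs] , rule sum_mono)
    fix p assume p: "p \<in> {p. p permutes {0..<m}}"
    have "(\<Prod>j=1..m. \<bar>F (Suc (p (j - 1))) j\<bar>) \<le> 1"
      using p by (intro prod_le_1) (auto intro!: assms simp: permutes_in_image[of _ "{0..<m}", simplified] Suc_le_eq)
    then show "\<bar>signof p * (\<Prod>j=1..m. F (Suc (p (j - 1))) j)\<bar> \<le> 1"
      by (simp add: abs_mult abs_prod sign_def)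
  qed
  then show ?thesis
    by (simp add: card_permutations)
qed

lemma finite_zero_PiE:
  assumes "finite A" and "\<And>i. i \<in> A \<Longrightarrow> finite (S i)"
  shows "finite (zero_PiE A S)"
proof (rule finite_subset)
  show "zero_PiE A S \<subseteq> {f. \<forall>i. (i \<in> A \<longrightarrow> f i \<in> \<Union>(S ` A)) \<and> (i \<notin> A \<longrightarrow> f i = 0)}"
    by (auto simp: zero_PiE_def)
  show "finite {f. \<forall>i. (i \<in> A \<longrightarrow> f i \<in> \<Union>(S ` A)) \<and> (i \<notin> A \<longrightarrow> f i = 0)}"
    using assms by (intro finite_set_of_finite_funs) auto
qed

section \<open>The bialternant formula\<close>

text \<open>Translates the cardinalities by which row lengths and conjugate partitions are defined
  into inequalities between indices.\<close>

lemma initial_segment_eq: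
  fixes S :: "nat set"
  assumes "S \<subseteq> {1..k}" and "\<And>j j'. j \<in> S \<Longrightarrow> 1 \<le> j' \<Longrightarrow> j' \<le> j \<Longrightarrow> j' \<in> S"
  shows "S = {1..card S}"
proof (cases "S = {}")
  case False
  have "finite S"
    using assms(1) finite_subset by blast
  then have S: "S = {1..Max S}"
    using assms(1) assms(2)[OF Max_in[OF _ False]] by auto
  have "card S = Max S"
    using trans[OF arg_cong[OF S, of card] card_atLeastAtMost] by linarith
  then show ?thesis
    by (rule ssubst) (rule S)
qed simp

lemma partition_parts_le_antimono:
  assumes "partition_parts_le n \<kappa>" "1 \<le> i" "i \<le> i'"
  shows "\<kappa> i' \<le> \<kappa> i"
  using assms(3)
proof (induction rule: dec_induct)
  case (step k)
  then have "\<kappa> (Suc k) \<le> \<kappa> k"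
    using assms by (auto simp: partition_parts_le_def)
  with step show ?case by simp
qed simp

lemma young_diagram_eq_Sigma:
  assumes "\<And>i. i > n \<Longrightarrow> \<kappa> i = 0"
  shows "young_diagram \<kappa> = Sigma {1..n} (\<lambda>i. {1..\<kappa> i})"
proof -
  have "i \<le> n" if "1 \<le> j" "j \<le> \<kappa> i" for i j
    using that assms[of i] by (cases "i \<le> n") auto
  then show ?thesis
    by (fastforce simp: young_diagram_def)
qed

lemma young_diagram_mono:
  assumes "\<And>i. \<kappa>' i \<le> \<kappa> i"
  shows "young_diagram \<kappa>' \<subseteq> young_diagram \<kappa>"
  using order_trans[OF _ assms] by (auto simp: young_diagram_def)

lemma finite_young_diagram: "partition_parts_le n \<kappa> \<Longrightarrow> finite (young_diagram \<kappa>)"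
  by (subst young_diagram_eq_Sigma[of n]) (auto simp: partition_parts_le_def)

lemma SSYTD:
  assumes "T \<in> SSYT n \<kappa>"
  shows SSYT_outside: "\<And>i j. (i, j) \<notin> young_diagram \<kappa> \<Longrightarrow> T i j = 0"
    and SSYT_range: "\<And>i j. (i, j) \<in> young_diagram \<kappa> \<Longrightarrow> 1 \<le> T i j \<and> T i j \<le> n"
    and SSYT_row: "\<And>i j j'. (i, j) \<in> young_diagram \<kappa> \<Longrightarrow> (i, j') \<in> young_diagram \<kappa> \<Longrightarrow> j \<le> j' \<Longrightarrow> T i j \<le> T i j'"
    and SSYT_column: "\<And>i i' j. (i, j) \<in> young_diagram \<kappa> \<Longrightarrow> (i', j) \<in> young_diagram \<kappa> \<Longrightarrow> i < i' \<Longrightarrow> T i j < T i' j"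
  using assms by (auto simp: SSYT_def)

lemma finite_SSYT:
  assumes "finite (young_diagram \<kappa>)"
  shows "finite (SSYT n \<kappa>)"
proof -
  let ?F = "{f. \<forall>c. (c \<in> young_diagram \<kappa> \<longrightarrow> f c \<in> {1..n}) \<and> (c \<notin> young_diagram \<kappa> \<longrightarrow> f c = 0)}"
  have "finite ?F"
    using assms by (rule finite_set_of_finite_funs) simp
  moreover have "SSYT n \<kappa> \<subseteq> curry ` ?F"
  proof
    fix T assume "T \<in> SSYT n \<kappa>"
    then have "case_prod T \<in> ?F"
      by (auto simp: SSYT_def)
    then show "T \<in> curry ` ?F"
      by (intro image_eqI[where x = "case_prod T"]) auto
  qed
  ultimately show ?thesis
    using finite_surj by blast
qed

text \<open>Down a column the entries start at 1 or above and increase strictly. Hence entries at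
  most \<open>n\<close> lie in the first \<open>n\<close> rows, which bounds the number of parts in
  the branching rule.\<close>

lemma SSYT_ge_row:
  assumes T: "T \<in> SSYT n \<kappa>" and \<kappa>: "partition_parts_le m \<kappa>" and "(i, j) \<in> young_diagram \<kappa>"
  shows "i \<le> T i j"
  using assms(3)
proof (induction i)
  case (Suc i)
  show ?case
  proof (cases "i = 0")
    case True
    then show ?thesis
      using T Suc.prems by (fastforce simp: SSYT_def)
  next
    case False
    then have "(i, j) \<in> young_diagram \<kappa>"
      using Suc.prems partition_parts_le_antimono[OF \<kappa>, of i "Suc i"] by (auto simp: young_diagram_def)
    moreover from this have "T i j < T (Suc i) j"
      using T Suc.prems by (auto simp: SSYT_def)
    ultimately show ?thesis
      using Suc.IH by simp
  qed
qed simp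

text \<open>The cells with entry \<open>Suc n\<close> form a horizontal strip at the ends of the
  rows. Removing them leaves a tableau with entries up to \<open>n\<close> whose shape
  \<open>\<kappa>'\<close> interlaces with \<open>\<kappa>\<close>; each removed cell contributes a
  factor \<open>x (Suc n)\<close>.\<close>

lemma schur_branching:
  assumes \<kappa>: "partition_parts_le (Suc n) \<kappa>"
  shows "schur (Suc n) \<kappa> x =
    (\<Sum>\<kappa>'\<in>zero_PiE {1..n} (\<lambda>i. {\<kappa> (Suc i)..\<kappa> i}). x (Suc n) ^ (\<Sum>i=1..Suc n. \<kappa> i - \<kappa>' i) * schur n \<kappa>' x)"
proof -
  define I where "I = zero_PiE {1..n} (\<lambda>i. {\<kappa> (Suc i)..\<kappa> i})"
  note antimono = partition_parts_le_antimono[OF \<kappa>]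
  \<comment> \<open>The guard \<open>1 \<le> i\<close> makes the shape 0 at index 0, as membership
    in \<open>I\<close> requires.\<close>
  define sub where "sub = (\<lambda>T i. card {j \<in> {1..\<kappa> i}. 1 \<le> i \<and> T i j \<le> n})"
  define restr where "restr = (\<lambda>T i j. if (i, j) \<in> young_diagram (sub T) then T i j else (0::nat))"
  define ext where "ext = (\<lambda>(\<kappa>', T') i j. if (i, j) \<in> young_diagram \<kappa>' then T' i j
      else if (i, j) \<in> young_diagram \<kappa> then Suc n else 0)"
  have sub_iff: "T i j \<le> n \<longleftrightarrow> j \<le> sub T i"
    if "T \<in> SSYT (Suc n) \<kappa>" "(i, j) \<in> young_diagram \<kappa>" for T i j
  proof -
    have "{j \<in> {1..\<kappa> i}. 1 \<le> i \<and> T i j \<le> n} = {1..sub T i}"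
      unfolding sub_def
    proof (rule initial_segment_eq[of _ "\<kappa> i"])
      fix j j' assume j: "j \<in> {j \<in> {1..\<kappa> i}. 1 \<le> i \<and> T i j \<le> n}" "1 \<le> j'" "j' \<le> j"
      then have "T i j' \<le> T i j"
        by (intro SSYT_row[OF that(1)]) (auto simp: young_diagram_def)
      with j show "j' \<in> {j \<in> {1..\<kappa> i}. 1 \<le> i \<and> T i j \<le> n}"
        by auto
    qed auto
    then have "j \<in> {j \<in> {1..\<kappa> i}. 1 \<le> i \<and> T i j \<le> n} \<longleftrightarrow> j \<in> {1..sub T i}"
      by simp
    then show ?thesis
      using that by (simp add: young_diagram_def)
  qed
  have sub_le: "sub T i \<le> \<kappa> i" for T i
    unfolding sub_def by (rule order_trans[OF card_mono[of "{1..\<kappa> i}"]]) auto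
  have sub_0: "sub T 0 = 0" for T
    by (simp add: sub_def)
  have young_sub: "young_diagram (sub T) \<subseteq> young_diagram \<kappa>" for T
    by (rule young_diagram_mono) (rule sub_le)
  have young_I: "young_diagram \<kappa>' \<subseteq> young_diagram \<kappa>" if "\<kappa>' \<in> I" for \<kappa>'
  proof -
    have "\<kappa>' i \<le> \<kappa> i" for i
      using that by (cases "i \<in> {1..n}") (auto simp: I_def zero_PiE_def)
    then show ?thesis
      by (rule young_diagram_mono)
  qed
  have sub_mem: "sub T \<in> I" if T: "T \<in> SSYT (Suc n) \<kappa>" for T
  proof -
    have "\<kappa> (Suc i) \<le> sub T i" if i: "i \<in> {1..n}" for i
    proof (cases "\<kappa> (Suc i) = 0")
      case False
      with i have c: "(Suc i, \<kappa> (Suc i)) \<in> young_diagram \<kappa>" "(i, \<kappa> (Suc i)) \<in> young_diagram \<kappa>"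
        using antimono[of i "Suc i"] by (auto simp: young_diagram_def)
      \<comment> \<open>The entry above the end of row \<open>Suc i\<close> is smaller than one
        bounded by \<open>Suc n\<close>, so its cell survives the removal.\<close>
      then have "T i (\<kappa> (Suc i)) < T (Suc i) (\<kappa> (Suc i))" "T (Suc i) (\<kappa> (Suc i)) \<le> Suc n"
        using T by (auto simp: SSYT_def)
      then show ?thesis
        using sub_iff[OF T c(2)] by simp
    qed simp
    moreover have "sub T i = 0" if "i > n" for i
    proof -
      have "{j \<in> {1..\<kappa> i}. 1 \<le> i \<and> T i j \<le> n} = {}"
        using SSYT_ge_row[OF T \<kappa>, of i] that by (force simp: young_diagram_def)
      then show ?thesis
        by (simp only: sub_def card.empty)
    qed
    ultimately show ?thesis
      using sub_le sub_0 gr0I[of "_ :: nat"] unfolding I_def zero_PiE_def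
      by (auto simp: Suc_le_eq not_le)
  qed
  have restr_mem: "restr T \<in> SSYT n (sub T)" if T: "T \<in> SSYT (Suc n) \<kappa>" for T
  proof -
    have mem: "(i, j) \<in> young_diagram \<kappa>" if "(i, j) \<in> young_diagram (sub T)" for i j
      using that young_sub by blast
    have "T i j \<le> n" if "(i, j) \<in> young_diagram (sub T)" for i j
      using that sub_iff[OF T mem[OF that]] by (simp add: young_diagram_def)
    then show ?thesis
      using SSYT_range[OF T mem] SSYT_row[OF T mem mem] SSYT_column[OF T mem mem]
      unfolding SSYT_def restr_def by simp
  qed
  have ext_mem: "ext (\<kappa>', T) \<in> SSYT (Suc n) \<kappa>" if \<kappa>': "\<kappa>' \<in> I" and T: "T \<in> SSYT n \<kappa>'" for \<kappa>' T
  proof -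
    \<comment> \<open>Row \<open>i\<close> of \<open>\<kappa>'\<close> is at least as long as row
      \<open>Suc i\<close> of \<open>\<kappa>\<close>, so only the lowest cell of a column can lie
      outside \<open>\<kappa>'\<close>. Filling the strip with \<open>Suc n\<close> then keeps
      columns strict.\<close>
    have up: "(i, j) \<in> young_diagram \<kappa>'" if "(i, j) \<in> young_diagram \<kappa>" "(i', j) \<in> young_diagram \<kappa>" "i < i'" for i i' j
    proof -
      have "i' \<le> Suc n"
        using that \<kappa> by (auto simp: partition_parts_le_def young_diagram_def not_le[symmetric])
      then have "\<kappa> (Suc i) \<le> \<kappa>' i"
        using that \<kappa>' by (auto simp: I_def zero_PiE_def young_diagram_def)
      moreover have "\<kappa> i' \<le> \<kappa> (Suc i)"
        using that by (intro antimono) auto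
      ultimately show ?thesis
        using that by (auto simp: young_diagram_def)
    qed
    have le: "T i j \<le> n" "1 \<le> T i j" if "(i, j) \<in> young_diagram \<kappa>'" for i j
      using that T by (auto simp: SSYT_def)
    have left: "(i, j) \<in> young_diagram \<kappa>'" if "(i, j') \<in> young_diagram \<kappa>'" "(i, j) \<in> young_diagram \<kappa>" "j \<le> j'" for i j j'
      using that by (auto simp: young_diagram_def)
    have row: "T i j \<le> T i j'" if "(i, j) \<in> young_diagram \<kappa>'" "(i, j') \<in> young_diagram \<kappa>'" "j \<le> j'" for i j j'
      using that T by (auto simp: SSYT_def)
    have column: "T i j < T i' j" if "(i, j) \<in> young_diagram \<kappa>'" "(i', j) \<in> young_diagram \<kappa>'" "i < i'" for i i' j
      using that T by (auto simp: SSYT_def)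
    have mem: "(i, j) \<in> young_diagram \<kappa>" if "(i, j) \<in> young_diagram \<kappa>'" for i j
      using that young_I[OF \<kappa>'] by blast
    show ?thesis
      unfolding SSYT_def mem_Collect_eq
    proof (intro conjI allI impI; (elim conjE)?)
      fix i j assume "(i, j) \<notin> young_diagram \<kappa>"
      then show "ext (\<kappa>', T) i j = 0"
        using mem by (auto simp: ext_def)
    next
      fix i j assume "(i, j) \<in> young_diagram \<kappa>"
      then show "ext (\<kappa>', T) i j \<in> {1..Suc n}"
        using le[of i j] by (auto simp: ext_def)
    next
      fix i j j' assume "(i, j) \<in> young_diagram \<kappa>" "(i, j') \<in> young_diagram \<kappa>" "j \<le> j'"
      then show "ext (\<kappa>', T) i j \<le> ext (\<kappa>', T) i j'"
        using le(1)[of i j] left[of i j' j] row[of i j j'] by (auto simp: ext_def)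
    next
      fix i i' j assume *: "(i, j) \<in> young_diagram \<kappa>" "(i', j) \<in> young_diagram \<kappa>" "i < i'"
      then show "ext (\<kappa>', T) i j < ext (\<kappa>', T) i' j"
        using le(1)[of i j] up[OF *] column[of i j i'] by (auto simp: ext_def)
    qed
  qed
  have sub_ext: "sub (ext (\<kappa>', T)) = \<kappa>'" if \<kappa>': "\<kappa>' \<in> I" and T: "T \<in> SSYT n \<kappa>'" for \<kappa>' T
  proof
    fix i
    have "{j \<in> {1..\<kappa> i}. 1 \<le> i \<and> ext (\<kappa>', T) i j \<le> n} = {1..\<kappa>' i}"
    proof (cases "i = 0")
      case True
      then show ?thesis
        using \<kappa>' by (simp add: I_def zero_PiE_def)
    next
      case False
      have "(i, j) \<in> young_diagram \<kappa>" if "(i, j) \<in> young_diagram \<kappa>'" for j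
        using that young_I[OF \<kappa>'] by blast
      with False show ?thesis
        using SSYT_range[OF T, of i]
        by (auto simp: ext_def young_diagram_def split: if_splits)
    qed
    then show "sub (ext (\<kappa>', T)) i = \<kappa>' i"
      unfolding sub_def by (simp only: card_atLeastAtMost diff_Suc_1)
  qed
  have weight: "(\<Prod>(i, j)\<in>young_diagram \<kappa>. x (T i j)) =
      x (Suc n) ^ (\<Sum>i=1..Suc n. \<kappa> i - sub T i) * (\<Prod>(i, j)\<in>young_diagram (sub T). x (restr T i j))"
    if T: "T \<in> SSYT (Suc n) \<kappa>" for T
  proof -
    have eq: "young_diagram \<kappa> = Sigma {1..Suc n} (\<lambda>i. {1..\<kappa> i})"
      using \<kappa> by (intro young_diagram_eq_Sigma) (auto simp: partition_parts_le_def)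
    have "card (young_diagram \<kappa> - young_diagram (sub T)) = card (Sigma {1..Suc n} (\<lambda>i. {1..\<kappa> i} - {1..sub T i}))"
      unfolding eq by (rule arg_cong[where f=card]) (auto simp: young_diagram_def)
    also have "\<dots> = (\<Sum>i=1..Suc n. \<kappa> i - sub T i)"
      using sub_le[of T] by (subst card_SigmaI) (auto simp: card_Diff_subset)
    finally have card: "card (young_diagram \<kappa> - young_diagram (sub T)) = (\<Sum>i=1..Suc n. \<kappa> i - sub T i)" .
    have "T i j = Suc n" if "(i, j) \<in> young_diagram \<kappa> - young_diagram (sub T)" for i j
    proof -
      have "T i j \<le> Suc n" "\<not> T i j \<le> n"
        using T that sub_iff[OF T, of i j] by (auto simp: SSYT_def young_diagram_def)
      then show ?thesis by simp
    qed
    then have "(\<Prod>(i, j)\<in>young_diagram \<kappa> - young_diagram (sub T). x (T i j)) =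
        (\<Prod>(i, j)\<in>young_diagram \<kappa> - young_diagram (sub T). x (Suc n))"
      by (intro prod.cong) auto
    also have "\<dots> = x (Suc n) ^ card (young_diagram \<kappa> - young_diagram (sub T))"
      by (simp add: case_prod_unfold)
    also note card
    finally have "(\<Prod>(i, j)\<in>young_diagram \<kappa> - young_diagram (sub T). x (T i j)) =
        x (Suc n) ^ (\<Sum>i=1..Suc n. \<kappa> i - sub T i)" .
    moreover have "(\<Prod>(i, j)\<in>young_diagram (sub T). x (T i j)) =
        (\<Prod>(i, j)\<in>young_diagram (sub T). x (restr T i j))"
      by (intro prod.cong) (auto simp: restr_def)
    moreover have "(\<Prod>(i, j)\<in>young_diagram \<kappa>. x (T i j)) =
        (\<Prod>(i, j)\<in>young_diagram \<kappa> - young_diagram (sub T). x (T i j)) *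
        (\<Prod>(i, j)\<in>young_diagram (sub T). x (T i j))"
      using young_sub[of T] finite_young_diagram[OF \<kappa>] by (rule prod.subset_diff)
    ultimately show ?thesis by simp
  qed
  have "schur (Suc n) \<kappa> x = (\<Sum>(\<kappa>', T)\<in>Sigma I (SSYT n).
      x (Suc n) ^ (\<Sum>i=1..Suc n. \<kappa> i - \<kappa>' i) * (\<Prod>(i, j)\<in>young_diagram \<kappa>'. x (T i j)))"
    unfolding schur_def
  proof (rule sum.reindex_bij_witness[where i = ext and j = "\<lambda>T. (sub T, restr T)"])
    fix T assume T: "T \<in> SSYT (Suc n) \<kappa>"
    show "ext (sub T, restr T) = T"
    proof (intro HOL.ext)
      fix i j
      show "ext (sub T, restr T) i j = T i j"
      proof (cases "(i, j) \<in> young_diagram \<kappa>")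
        case True
        then have "(i, j) \<in> young_diagram (sub T) \<longleftrightarrow> T i j \<le> n"
          using sub_iff[OF T True] by (auto simp: young_diagram_def)
        then show ?thesis
          using True SSYT_range[OF T True] by (auto simp: ext_def restr_def)
      next
        case False
        then have "(i, j) \<notin> young_diagram (sub T)"
          using young_sub by blast
        with False show ?thesis
          using SSYT_outside[OF T False] by (auto simp: ext_def)
      qed
    qed
    show "(sub T, restr T) \<in> Sigma I (SSYT n)"
      using sub_mem[OF T] restr_mem[OF T] by simp
  next
    fix p assume p: "p \<in> Sigma I (SSYT n)"
    then obtain \<kappa>' T where [simp]: "p = (\<kappa>', T)" and *: "\<kappa>' \<in> I" "T \<in> SSYT n \<kappa>'"
      by auto
    have "restr (ext p) = T"
    proof (intro HOL.ext)
      fix i j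
      show "restr (ext p) i j = T i j"
        using SSYT_outside[OF *(2), of i j] sub_ext[OF *] by (simp add: restr_def) (simp add: ext_def)
    qed
    then show "(sub (ext p), restr (ext p)) = p"
      using sub_ext[OF *] by simp
    show "ext p \<in> SSYT (Suc n) \<kappa>"
      using ext_mem[OF *] by simp
  qed (simp add: weight)
  also have "\<dots> = (\<Sum>\<kappa>'\<in>I. x (Suc n) ^ (\<Sum>i=1..Suc n. \<kappa> i - \<kappa>' i) * schur n \<kappa>' x)"
  proof (subst sum.Sigma[symmetric])
    show "finite I"
      unfolding I_def by (rule finite_zero_PiE) auto
    show "\<forall>\<kappa>'\<in>I. finite (SSYT n \<kappa>')"
      using finite_SSYT[OF finite_subset[OF young_I finite_young_diagram[OF \<kappa>]]] by simp
  qed (simp add: schur_def sum_distrib_left)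
  finally show ?thesis
    by (simp add: I_def)
qed

text \<open>A homogeneous geometric sum. Keeping \<open>x - z\<close> as a factor instead of
  dividing by it covers \<open>x = z\<close> as well.\<close>

lemma telescope_powers:
  fixes x z :: real
  assumes "a \<le> b"
  shows "(x - z) * (\<Sum>m=a..b. z ^ (b - m) * x ^ m) = x ^ Suc b - z ^ (Suc b - a) * x ^ a"
  using assms
proof (induction rule: dec_induct)
  case (step b)
  have "(\<Sum>m=a..b. z ^ (Suc b - m) * x ^ m) = z * (\<Sum>m=a..b. z ^ (b - m) * x ^ m)"
    by (auto simp: sum_distrib_left Suc_diff_le intro!: sum.cong)
  then have "(x - z) * (\<Sum>m=a..Suc b. z ^ (Suc b - m) * x ^ m) =
      z * ((x - z) * (\<Sum>m=a..b. z ^ (b - m) * x ^ m)) + (x - z) * x ^ Suc b"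
    using step.hyps by (simp add: algebra_simps)
  also have "\<dots> = x ^ Suc (Suc b) - z ^ (Suc (Suc b) - a) * x ^ a"
    using step.hyps unfolding step.IH by (simp add: Suc_diff_le algebra_simps)
  finally show ?case .
qed (simp add: algebra_simps)

text \<open>Induction on \<open>n\<close>. With \<open>z\<close> the last variable, column
  operations clear the last row except for its final entry, and every other entry becomes
  \<open>x i - z\<close> times a geometric sum. Expanding these sums yields the shapes of the
  branching rule, while the factors \<open>x i - z\<close> complete the Vandermonde product. The
  form without division also holds where coordinates coincide.\<close>

lemma bialternant:
  assumes "partition_parts_le n \<kappa>"
  shows "det1 n (\<lambda>i j. x i ^ (\<kappa> j + n - j)) = schur n \<kappa> x * (\<Prod>j=1..n. \<Prod>i=1..<j. x i - x j)"
  using assms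
proof (induction n arbitrary: \<kappa>)
  case 0
  then have "young_diagram \<kappa> = {}"
    by (auto simp: young_diagram_def partition_parts_le_def)
  then have "SSYT 0 \<kappa> = {\<lambda>_ _. 0}" "young_diagram \<kappa> = {}"
    by (auto simp: SSYT_def fun_eq_iff)
  then show ?case
    by (simp add: schur_def)
next
  case (Suc n)
  define z where "z = x (Suc n)"
  define I where "I = zero_PiE {1..n} (\<lambda>i. {\<kappa> (Suc i)..\<kappa> i})"
  define L where "L = (\<lambda>j. \<kappa> j + Suc n - j)"
  have dec: "\<kappa> (Suc j) \<le> \<kappa> j" if "j \<in> {1..n}" for j
    using partition_parts_le_antimono[OF Suc.prems, of j "Suc j"] that by simp
  let ?G = "\<lambda>i j. if j < Suc n then x i ^ L j - z ^ (L j - L (Suc j)) * x i ^ L (Suc j) else x i ^ L j"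
  have "det1 (Suc n) (\<lambda>i j. x i ^ L j) = det1 (Suc n) ?G"
    by (rule det1_col_ops[symmetric])
  also have "\<dots> = ?G (Suc n) (Suc n) * det1 n ?G"
  proof (rule det1_last_row)
    fix j assume j: "j \<in> {1..n}"
    then have "L (Suc j) \<le> L j"
      using dec[OF j] by (simp add: L_def)
    then have "z ^ (L j - L (Suc j)) * z ^ L (Suc j) = z ^ L j"
      by (simp flip: power_add)
    with j show "?G (Suc n) j = 0"
      by (simp add: z_def)
  qed
  also have "?G (Suc n) (Suc n) = z ^ \<kappa> (Suc n)"
    by (simp add: L_def z_def)
  also have "det1 n ?G = (\<Sum>\<kappa>'\<in>I. det1 n (\<lambda>i j. (x i - z) * z ^ (\<kappa> j - \<kappa>' j) * x i ^ (\<kappa>' j + n - j)))"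
  proof -
    \<comment> \<open>Finite sums are phrased with \<open>has_sum\<close> so that one expansion
      lemma for determinants serves here and for the infinite series below. The exponent
      \<open>L j - L (Suc j)\<close> is the number of values of \<open>m\<close>.\<close>
    have "((\<lambda>m. (x i - z) * z ^ (\<kappa> j - m) * x i ^ (m + n - j)) has_sum ?G i j) {\<kappa> (Suc j)..\<kappa> j}"
      if "i \<in> {1..n}" "j \<in> {1..n}" for i j
    proof (rule has_sum_finiteI)
      have "x i ^ (m + n - j) = x i ^ m * x i ^ (n - j)" for m
        using that by (simp flip: power_add)
      then have "(\<Sum>m=\<kappa> (Suc j)..\<kappa> j. (x i - z) * z ^ (\<kappa> j - m) * x i ^ (m + n - j)) =
          x i ^ (n - j) * ((x i - z) * (\<Sum>m=\<kappa> (Suc j)..\<kappa> j. z ^ (\<kappa> j - m) * x i ^ m))"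
        by (simp add: sum_distrib_left mult_ac)
      also have "\<dots> = ?G i j"
      proof -
        have "L j = Suc (\<kappa> j) + (n - j)" "L (Suc j) = \<kappa> (Suc j) + (n - j)"
          using that by (auto simp: L_def)
        then have "L j - L (Suc j) = Suc (\<kappa> j) - \<kappa> (Suc j)"
            "x i ^ L j = x i ^ Suc (\<kappa> j) * x i ^ (n - j)" "x i ^ L (Suc j) = x i ^ \<kappa> (Suc j) * x i ^ (n - j)"
          by (simp_all only: power_add diff_cancel2)
        then show ?thesis
          using that unfolding telescope_powers[OF dec[OF that(2)]]
          by (simp add: right_diff_distrib mult_ac del: power_Suc)
      qed
      finally show "?G i j = (\<Sum>m=\<kappa> (Suc j)..\<kappa> j. (x i - z) * z ^ (\<kappa> j - m) * x i ^ (m + n - j))"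
        by (rule sym)
    qed simp
    then have has: "((\<lambda>\<kappa>'. det1 n (\<lambda>i j. (x i - z) * z ^ (\<kappa> j - \<kappa>' j) * x i ^ (\<kappa>' j + n - j))) has_sum det1 n ?G) I"
      unfolding I_def by (rule has_sum_det1)
    have "finite I"
      unfolding I_def by (rule finite_zero_PiE) auto
    then show ?thesis
      by (rule trans[OF infsumI[OF has, symmetric] infsum_finite])
  qed
  also have "z ^ \<kappa> (Suc n) * \<dots> = (\<Sum>\<kappa>'\<in>I. (\<Prod>i=1..n. x i - z) * (\<Prod>j=1..n. \<Prod>i=1..<j. x i - x j) *
      (x (Suc n) ^ (\<Sum>i=1..Suc n. \<kappa> i - \<kappa>' i) * schur n \<kappa>' x))"
    unfolding sum_distrib_left
  proof (rule sum.cong)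
    fix \<kappa>' assume \<kappa>': "\<kappa>' \<in> I"
    have zero: "\<kappa>' i = 0" if "i > n" for i
      using that \<kappa>' by (simp add: I_def zero_PiE_def)
    have "\<kappa>' (Suc i) \<le> \<kappa>' i" if "i \<ge> 1" for i
    proof (cases "i < n")
      case True
      then have "\<kappa>' (Suc i) \<le> \<kappa> (Suc i)" "\<kappa> (Suc i) \<le> \<kappa>' i"
        using \<kappa>' that by (auto simp: I_def zero_PiE_def)
      then show ?thesis by simp
    qed (simp add: zero)
    with zero have "partition_parts_le n \<kappa>'"
      by (simp add: partition_parts_le_def)
    then have "det1 n (\<lambda>i j. x i ^ (\<kappa>' j + n - j)) = schur n \<kappa>' x * (\<Prod>j=1..n. \<Prod>i=1..<j. x i - x j)"
      by (rule Suc.IH)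
    \<comment> \<open>The factor \<open>z ^ \<kappa> (Suc n)\<close> supplies the term
      \<open>i = Suc n\<close> of the exponent in the branching rule, because
      \<open>\<kappa>'\<close> vanishes there.\<close>
    then show "z ^ \<kappa> (Suc n) * det1 n (\<lambda>i j. (x i - z) * z ^ (\<kappa> j - \<kappa>' j) * x i ^ (\<kappa>' j + n - j)) =
        (\<Prod>i=1..n. x i - z) * (\<Prod>j=1..n. \<Prod>i=1..<j. x i - x j) *
        (x (Suc n) ^ (\<Sum>i=1..Suc n. \<kappa> i - \<kappa>' i) * schur n \<kappa>' x)"
      unfolding det1_scale[of n "\<lambda>i. x i - z" "\<lambda>j. z ^ (\<kappa> j - \<kappa>' j)"]
      by (simp add: zero power_add power_sum z_def mult_ac)
  qed simp
  also have "\<dots> = schur (Suc n) \<kappa> x * (\<Prod>j=1..Suc n. \<Prod>i=1..<j. x i - x j)"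
    unfolding schur_branching[OF Suc.prems] sum_distrib_left[symmetric] I_def
    by (simp add: z_def mult_ac atLeastLessThanSuc_atLeastAtMost)
  finally show ?case
    by (simp add: L_def)
qed

section \<open>One half of a reverse plane partition\<close>

text \<open>
  \<open>T i c\<close> is the entry of row \<open>i\<close> on the \<open>c\<close>-th superdiagonal, that is in column \<open>i + c\<close>; the
  prescribed diagonal is \<open>c = 0\<close>. For the lower half the roles of rows and columns are exchanged.
\<close>

definition half_RPP :: "nat \<Rightarrow> (nat \<Rightarrow> nat) \<Rightarrow> (nat \<Rightarrow> nat) \<Rightarrow> (nat \<Rightarrow> nat \<Rightarrow> nat) set" where
  "half_RPP m L e = {T.
     (\<forall>i. T i 0 = e i) \<and>
     (\<forall>i c. \<not> (1 \<le> i \<and> i \<le> m \<and> c \<le> L i) \<longrightarrow> T i c = 0) \<and>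
     (\<forall>i c. 1 \<le> i \<and> i \<le> m \<and> c < L i \<longrightarrow> T i c \<le> T i (Suc c)) \<and>
     (\<forall>i c. 1 \<le> i \<and> i < m \<and> c \<le> L (Suc i) \<longrightarrow> T i (Suc c) \<le> T (Suc i) c)}"

text \<open>The summation starts at \<open>c = 1\<close>, since the diagonal is shared by the two
  halves and gets its weight separately.\<close>

definition half_size :: "nat \<Rightarrow> (nat \<Rightarrow> nat) \<Rightarrow> (nat \<Rightarrow> nat \<Rightarrow> nat) \<Rightarrow> nat" where
  "half_size m L T = (\<Sum>i=1..m. \<Sum>c=1..L i. T i c)"

definition increasing_diagonals :: "nat \<Rightarrow> (nat \<Rightarrow> nat) set" where
  "increasing_diagonals m = {e. (\<forall>i. 1 \<le> i \<and> i < m \<longrightarrow> e i \<le> e (Suc i)) \<and> (\<forall>i. i \<notin> {1..m} \<longrightarrow> e i = 0)}"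

text \<open>
  The diagonal after \<open>e\<close> has \<open>m' = m\<close> entries, the last of them unbounded, if the last row is
  nonempty, and \<open>m' = m - 1\<close> entries otherwise.
\<close>

definition interlacing :: "nat \<Rightarrow> nat \<Rightarrow> (nat \<Rightarrow> nat) \<Rightarrow> (nat \<Rightarrow> nat) set" where
  "interlacing m m' e = zero_PiE {1..m'} (\<lambda>i. if i < m then {e i..e (Suc i)} else {e i..})"

lemma half_RPPD:
  assumes "T \<in> half_RPP m L e"
  shows half_RPP_diag: "\<And>i. T i 0 = e i"
    and half_RPP_outside: "\<And>i c. \<not> (1 \<le> i \<and> i \<le> m \<and> c \<le> L i) \<Longrightarrow> T i c = 0"
    and half_RPP_row: "\<And>i c. 1 \<le> i \<Longrightarrow> i \<le> m \<Longrightarrow> c < L i \<Longrightarrow> T i c \<le> T i (Suc c)"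
    and half_RPP_column: "\<And>i c. 1 \<le> i \<Longrightarrow> i < m \<Longrightarrow> c \<le> L (Suc i) \<Longrightarrow> T i (Suc c) \<le> T (Suc i) c"
  using assms by (auto simp: half_RPP_def)

lemma half_RPPI:
  assumes "\<And>i. T i 0 = e i"
    and "\<And>i c. \<not> (1 \<le> i \<and> i \<le> m \<and> c \<le> L i) \<Longrightarrow> T i c = 0"
    and "\<And>i c. 1 \<le> i \<Longrightarrow> i \<le> m \<Longrightarrow> c < L i \<Longrightarrow> T i c \<le> T i (Suc c)"
    and "\<And>i c. 1 \<le> i \<Longrightarrow> i < m \<Longrightarrow> c \<le> L (Suc i) \<Longrightarrow> T i (Suc c) \<le> T (Suc i) c"
  shows "T \<in> half_RPP m L e"
  using assms by (simp add: half_RPP_def)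

text \<open>The superdiagonals are shifted by one. The inequalities between superdiagonals 0 and 1
  are the interlacing conditions, and what remains is a half with prescribed diagonal
  \<open>e'\<close> and rows shorter by one. An empty last row disappears at the same time.\<close>

lemma has_sum_half_RPP_peel:
  fixes q :: real
  assumes m': "m' = m \<or> m = Suc m' \<and> L m = 0" and pos: "\<And>i. i \<in> {1..m'} \<Longrightarrow> 1 \<le> L i"
    and e: "e \<in> increasing_diagonals m"
  shows "((\<lambda>T. q ^ half_size m L T) has_sum S) (half_RPP m L e) \<longleftrightarrow>
    ((\<lambda>(e', T). q ^ (\<Sum>i=1..m'. e' i) * q ^ half_size m' (\<lambda>i. L i - 1) T) has_sum S)
      (Sigma (interlacing m m' e) (half_RPP m' (\<lambda>i. L i - 1)))"
proof (rule has_sum_reindex_bij_witness[where j = "\<lambda>T. (\<lambda>i. T i 1, \<lambda>i c. T i (Suc c))"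
      and i = "\<lambda>(e', T) i c. case c of 0 \<Rightarrow> e i | Suc c \<Rightarrow> T i c"])
  have le_m: "i \<le> m" if "i \<le> m'" for i
    using that m' by auto
  have L_pos: "i \<le> m'" if "i \<le> m" "0 < L i" for i
    using that m' by (cases "i = m") auto
  fix T assume T: "T \<in> half_RPP m L e"
  show "(case (\<lambda>i. T i 1, \<lambda>i c. T i (Suc c)) of (e', T) \<Rightarrow> \<lambda>i c. case c of 0 \<Rightarrow> e i | Suc c \<Rightarrow> T i c) = T"
    using half_RPP_diag[OF T] by (auto simp: fun_eq_iff split: nat.split)
  have "(\<lambda>i. T i 1) \<in> interlacing m m' e"
    unfolding interlacing_def zero_PiE_def mem_Collect_eq
  proof (intro conjI ballI allI impI)
    fix i assume i: "i \<in> {1..m'}"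
    then have "e i \<le> T i 1"
      using half_RPP_row[OF T, of i 0] half_RPP_diag[OF T, of i] pos[OF i] le_m[of i] by simp
    moreover have "T i 1 \<le> e (Suc i)" if "i < m"
      using half_RPP_column[OF T, of i 0] half_RPP_diag[OF T, of "Suc i"] i that by simp
    ultimately show "T i 1 \<in> (if i < m then {e i..e (Suc i)} else {e i..})"
      by simp
  next
    fix i assume "i \<notin> {1..m'}"
    then show "T i 1 = 0"
      using half_RPP_outside[OF T, of i 1] L_pos[of i] by force
  qed
  moreover have "(\<lambda>i c. T i (Suc c)) \<in> half_RPP m' (\<lambda>i. L i - 1) (\<lambda>i. T i 1)"
  proof (rule half_RPPI)
    fix i c assume "\<not> (1 \<le> i \<and> i \<le> m' \<and> c \<le> L i - 1)"
    then show "T i (Suc c) = 0"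
      using half_RPP_outside[OF T, of i "Suc c"] L_pos[of i] by force
  next
    fix i c assume "1 \<le> i" "i \<le> m'" "c < L i - 1"
    then show "T i (Suc c) \<le> T i (Suc (Suc c))"
      using half_RPP_row[OF T, of i "Suc c"] le_m[of i] by simp
  next
    fix i c assume "1 \<le> i" "i < m'" "c \<le> L (Suc i) - 1"
    then show "T i (Suc (Suc c)) \<le> T (Suc i) (Suc c)"
      using half_RPP_column[OF T, of i "Suc c"] le_m[of "Suc i"] pos[of "Suc i"] by simp
  qed simp
  ultimately show "(\<lambda>i. T i 1, \<lambda>i c. T i (Suc c)) \<in> Sigma (interlacing m m' e) (half_RPP m' (\<lambda>i. L i - 1))"
    by simp
  have "half_size m L T = (\<Sum>i=1..m'. \<Sum>c=1..L i. T i c)"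
    using m' by (auto simp: half_size_def)
  also have "\<dots> = (\<Sum>i=1..m'. T i 1 + (\<Sum>c=1..L i - 1. T i (Suc c)))"
  proof (rule sum.cong)
    fix i assume "i \<in> {1..m'}"
    then obtain l where "L i = Suc l"
      using pos[of i] by (cases "L i") auto
    then show "(\<Sum>c=1..L i. T i c) = T i 1 + (\<Sum>c=1..L i - 1. T i (Suc c))"
      by (simp add: sum.atLeast_Suc_atMost sum.atLeast_Suc_atMost_Suc_shift del: sum.cl_ivl_Suc)
  qed simp
  finally show "(case (\<lambda>i. T i 1, \<lambda>i c. T i (Suc c)) of (e', T) \<Rightarrow>
      q ^ (\<Sum>i=1..m'. e' i) * q ^ half_size m' (\<lambda>i. L i - 1) T) = q ^ half_size m L T"
    by (simp add: half_size_def sum.distrib power_add)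
next
  have le_m: "i \<le> m" if "i \<le> m'" for i
    using that m' by auto
  have L_pos: "i \<le> m'" if "i \<le> m" "0 < L i" for i
    using that m' by (cases "i = m") auto
  fix p assume "p \<in> Sigma (interlacing m m' e) (half_RPP m' (\<lambda>i. L i - 1))"
  then obtain e' T where p: "p = (e', T)" and e': "e' \<in> interlacing m m' e"
    and T: "T \<in> half_RPP m' (\<lambda>i. L i - 1) e'" by auto
  let ?U = "\<lambda>i c. case c of 0 \<Rightarrow> e i | Suc c \<Rightarrow> T i c"
  show "(\<lambda>i. (case p of (e', T) \<Rightarrow> \<lambda>i c. case c of 0 \<Rightarrow> e i | Suc c \<Rightarrow> T i c) i 1,
      \<lambda>i c. (case p of (e', T) \<Rightarrow> \<lambda>i c. case c of 0 \<Rightarrow> e i | Suc c \<Rightarrow> T i c) i (Suc c)) = p"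
    using half_RPP_diag[OF T] by (simp add: p)
  have ge: "e i \<le> e' i" if "1 \<le> i" "i \<le> m'" for i
  proof -
    have "i \<in> {1..m'}" using that by simp
    then have "e' i \<in> (if i < m then {e i..e (Suc i)} else {e i..})"
      using e' unfolding interlacing_def zero_PiE_def by blast
    then show ?thesis by (auto split: if_splits)
  qed
  have le: "e' i \<le> e (Suc i)" if "1 \<le> i" "i < m" for i
  proof -
    have "i \<in> {1..m'}" using that m' by auto
    then have "e' i \<in> (if i < m then {e i..e (Suc i)} else {e i..})"
      using e' unfolding interlacing_def zero_PiE_def by blast
    then show ?thesis using that by simp
  qed
  have "?U \<in> half_RPP m L e"
  proof (rule half_RPPI)
    fix i c assume *: "\<not> (1 \<le> i \<and> i \<le> m \<and> c \<le> L i)"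
    show "?U i c = 0"
    proof (cases c)
      case 0
      then show ?thesis using * e by (auto simp: increasing_diagonals_def)
    next
      case (Suc d)
      then have "\<not> (1 \<le> i \<and> i \<le> m' \<and> d \<le> L i - 1)"
        using * pos[of i] le_m[of i] by auto
      then show ?thesis
        using half_RPP_outside[OF T, of i d] Suc by simp
    qed
  next
    fix i c assume *: "1 \<le> i" "i \<le> m" "c < L i"
    then have "i \<le> m'" using L_pos[of i] by simp
    then show "?U i c \<le> ?U i (Suc c)"
      using * ge[of i] half_RPP_diag[OF T, of i] half_RPP_row[OF T, of i "c - 1"] by (cases c) auto
  next
    fix i c assume *: "1 \<le> i" "i < m" "c \<le> L (Suc i)"
    show "?U i (Suc c) \<le> ?U (Suc i) c"
    proof (cases c)
      case 0
      then show ?thesis using le[of i] * half_RPP_diag[OF T, of i] by simp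
    next
      case (Suc d)
      then have "Suc i \<le> m'" using * L_pos[of "Suc i"] by simp
      then show ?thesis
        using half_RPP_column[OF T, of i d] * Suc by simp
    qed
  qed simp
  then show "(case p of (e', T) \<Rightarrow> \<lambda>i c. case c of 0 \<Rightarrow> e i | Suc c \<Rightarrow> T i c) \<in> half_RPP m L e"
    by (simp add: p)
qed simp

text \<open>The summand is \<open>(q ^ (s + k)) ^ l / q ^ k\<close>, geometric in \<open>s\<close>
  with ratio \<open>q ^ l\<close>. For \<open>k = j - 1\<close> and \<open>b = e (Suc j)\<close> the
  upper endpoint \<open>q ^ (Suc b + k)\<close> is the base of column \<open>Suc j\<close>; the
  shift of the exponents by \<open>j - 1\<close> serves this match.\<close>

lemma has_sum_geometric_segment:
  fixes q :: real
  assumes q: "0 < q" "q < 1" and l: "1 \<le> l" and "a \<le> b"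
  shows "((\<lambda>s. q ^ s * (q ^ (s + k)) ^ (l - 1)) has_sum
    ((q ^ (a + k)) ^ l - (q ^ (Suc b + k)) ^ l) / (q ^ k * (1 - q ^ l))) {a..b}"
proof -
  have l1: "q ^ l < 1"
    using q l power_Suc_less_one[of q "l - 1"] by simp
  have "(\<Sum>s=a..b. q ^ s * (q ^ (s + k)) ^ (l - 1)) =
      ((q ^ (a + k)) ^ l - (q ^ (Suc b + k)) ^ l) / (q ^ k * (1 - q ^ l))"
    using \<open>a \<le> b\<close>
  proof (induction rule: dec_induct)
    case base
    obtain l' where "l = Suc l'" using l by (cases l) auto
    then show ?case
      using q l1 by (simp add: field_simps power_add power_mult_distrib flip: power_mult)
  next
    case (step b)
    obtain l' where l': "l = Suc l'" using l by (cases l) auto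
    have "q ^ Suc b * (q ^ (Suc b + k)) ^ (l - 1) =
      ((q ^ (Suc b + k)) ^ l - (q ^ (Suc (Suc b) + k)) ^ l) / (q ^ k * (1 - q ^ l))"
      using q l1 unfolding l' by (simp add: field_simps power_add power_mult_distrib flip: power_mult)
    then show ?case
      using step by (simp add: diff_divide_distrib)
  qed
  then show ?thesis
    by (intro has_sum_finiteI) auto
qed

text \<open>The case of the unbounded last entry: the term of the upper endpoint tends to 0, so that
  the last column stands alone.\<close>

lemma has_sum_geometric_tail:
  fixes q :: real
  assumes q: "0 < q" "q < 1" and l: "1 \<le> l"
  shows "((\<lambda>s. q ^ s * (q ^ (s + k)) ^ (l - 1)) has_sum (q ^ (a + k)) ^ l / (q ^ k * (1 - q ^ l))) {a..}"
proof -
  have l1: "q ^ l < 1"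
    using q l power_Suc_less_one[of q "l - 1"] by simp
  have "((\<lambda>i. (q ^ l) ^ i) has_sum 1 / (1 - q ^ l)) UNIV"
    using geometric_sums[of "q ^ l"] q l1 
    by (intro norm_summable_imp_has_sum) (auto simp: summable_geometric_iff)
  then have "((\<lambda>i. (q ^ (a + k)) ^ l / q ^ k * (q ^ l) ^ i) has_sum ((q ^ (a + k)) ^ l / q ^ k * (1 / (1 - q ^ l)))) UNIV"
    by (rule has_sum_cmult_right)
  moreover have "(q ^ (a + k)) ^ l / q ^ k * (q ^ l) ^ i = q ^ (a + i) * (q ^ (a + i + k)) ^ (l - 1)" for i
  proof -
    obtain l' where "l = Suc l'" using l by (cases l) auto
    then show ?thesis
      using q by (simp add: field_simps power_add power_mult_distrib flip: power_mult)
  qed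
  ultimately have "((\<lambda>i. q ^ (a + i) * (q ^ (a + i + k)) ^ (l - 1)) has_sum (q ^ (a + k)) ^ l / (q ^ k * (1 - q ^ l))) UNIV"
    by simp
  then show ?thesis
    by (subst has_sum_reindex_bij_witness[where j = "\<lambda>s. s - a" and i = "\<lambda>i. a + i" and T = UNIV]) auto
qed

lemma qq_poch_pos: "0 < q \<Longrightarrow> q < 1 \<Longrightarrow> 0 < qq_poch q k"
  unfolding qq_poch_def by (intro prod_pos) (auto simp: power_less_one_iff)

text \<open>Induction by stripping the diagonal: the number of rows drops or all rows shrink, so
  \<open>L 1 + m\<close> decreases. Summation over the new diagonal turns the columns into
  differences, which leave the alternant unchanged. The row factors \<open>1 - q ^ L i\<close> build
  up the products \<open>qq_poch\<close>, the column factors \<open>q ^ (j - 1)\<close> the power of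
  \<open>q\<close>.\<close>

lemma has_sum_half_RPP:
  fixes q :: real
  assumes q: "0 < q" "q < 1" and L: "\<And>i. 1 \<le> i \<Longrightarrow> i < m \<Longrightarrow> L (Suc i) < L i"
    and e: "e \<in> increasing_diagonals m"
  shows "((\<lambda>T. q ^ half_size m L T) has_sum
    det1 m (\<lambda>i j. (q ^ (e j + (j - 1))) ^ L i) /
    (q ^ (\<Sum>i=1..m. (i - 1) * L i) * (\<Prod>i=1..m. qq_poch q (L i)))) (half_RPP m L e)"
  using L e
proof (induction "L 1 + m" arbitrary: m L e rule: less_induct)
  case less
  show ?case
  proof (cases "m = 0")
    case True
    then have "half_RPP m L e = {\<lambda>_ _. 0}"
      using less.prems(2) by (auto simp: half_RPP_def increasing_diagonals_def fun_eq_iff)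
    moreover have "((\<lambda>T. q ^ half_size m L T) has_sum (\<Sum>T\<in>{\<lambda>_ _. 0}. q ^ half_size m L T)) {\<lambda>_ _. 0}"
      by (rule has_sum_finite) simp
    ultimately show ?thesis
      using True by (simp add: half_size_def)
  next
    case False
    define m' where "m' = (if L m = 0 then m - 1 else m)"
    define L' where "L' = (\<lambda>i. L i - 1)"
    define S where "S = (\<lambda>j. if j < m then {e j..e (Suc j)} else {e j..})"
    define y where "y = (\<lambda>j. q ^ (e j + (j - 1)))"
    let ?I = "interlacing m m' e"
    let ?C = "\<lambda>m L. q ^ (\<Sum>i=1..m. (i - 1) * L i) * (\<Prod>i=1..m. qq_poch q (L i))"
    have m': "m' = m \<or> m = Suc m' \<and> L m = 0"
      using False by (auto simp: m'_def)
    \<comment> \<open>\<open>L\<close> decreases strictly, so that only the last row can be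
      empty.\<close>
    have pos: "1 \<le> L i" if "i \<in> {1..m'}" for i
    proof (cases "i < m")
      case True
      then show ?thesis using less.prems(1)[of i] that by simp
    next
      case False
      then show ?thesis using that m' by (auto simp: m'_def split: if_splits)
    qed
    have e_le: "e j \<le> e (Suc j)" if "1 \<le> j" "j < m" for j
      using less.prems(2) that by (simp add: increasing_diagonals_def)
    have decreases: "L' 1 + m' < L 1 + m"
    proof (cases "m' = m")
      case True
      then have "1 \<le> L 1" using pos[of 1] False by simp
      with True show ?thesis by (simp add: L'_def)
    next
      case False
      then show ?thesis using m' by (auto simp: L'_def)
    qed
    have inner: "((\<lambda>T. q ^ half_size m' L' T) has_sum
        det1 m' (\<lambda>i j. (q ^ (e' j + (j - 1))) ^ L' i) / ?C m' L') (half_RPP m' L' e')"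
      if e': "e' \<in> ?I" for e'
    proof (rule less.hyps[where m=m' and L=L', OF decreases])
      fix i assume i: "1 \<le> i" "i < m'"
      then show "L' (Suc i) < L' i"
        using less.prems(1)[of i] pos[of "Suc i"] m' by (auto simp: L'_def)
    next
      have mem: "e' i \<in> S i" if "i \<in> {1..m'}" for i
        using e' that unfolding interlacing_def zero_PiE_def S_def by blast
      have "e' i \<le> e' (Suc i)" if "1 \<le> i" "i < m'" for i
      proof -
        have "e' i \<le> e (Suc i)"
          using mem[of i] that m' by (auto simp: S_def)
        also have "\<dots> \<le> e' (Suc i)"
          using mem[of "Suc i"] that by (auto simp: S_def split: if_splits)
        finally show ?thesis .
      qed
      then show "e' \<in> increasing_diagonals m'"
        using e' by (simp add: increasing_diagonals_def interlacing_def zero_PiE_def)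
    qed
    \<comment> \<open>The entries of the result are shaped to fit \<open>det1_scale\<close>, and the
      multiplier 1 to fit \<open>det1_col_ops\<close>.\<close>
    have "((\<lambda>e'. det1 m' (\<lambda>i j. q ^ e' j * (q ^ (e' j + (j - 1))) ^ (L i - 1))) has_sum
        det1 m' (\<lambda>i j. 1 / (1 - q ^ L i) * (1 / q ^ (j - 1)) *
          (if j < m then y j ^ L i - 1 * y (Suc j) ^ L i else y j ^ L i))) ?I"
      unfolding interlacing_def
    proof (rule has_sum_det1)
      fix i j assume ij: "i \<in> {1..m'}" "j \<in> {1..m'}"
      show "((\<lambda>s. q ^ s * (q ^ (s + (j - 1))) ^ (L i - 1)) has_sum
          1 / (1 - q ^ L i) * (1 / q ^ (j - 1)) *
          (if j < m then y j ^ L i - 1 * y (Suc j) ^ L i else y j ^ L i))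
          (if j < m then {e j..e (Suc j)} else {e j..})"
      proof (cases "j < m")
        case True
        have "y (Suc j) = q ^ (Suc (e (Suc j)) + (j - 1))"
          using ij by (simp add: y_def)
        then show ?thesis
          using has_sum_geometric_segment[OF q pos[OF ij(1)] e_le[OF _ True], of "j - 1"] True ij
          by (simp add: y_def mult.commute)
      next
        case False
        then show ?thesis
          using has_sum_geometric_tail[OF q pos[OF ij(1)], of "j - 1" "e j"]
          by (simp add: y_def mult.commute)
      qed
    qed
    also have "det1 m' (\<lambda>i j. 1 / (1 - q ^ L i) * (1 / q ^ (j - 1)) *
          (if j < m then y j ^ L i - 1 * y (Suc j) ^ L i else y j ^ L i)) =
        (\<Prod>i=1..m'. 1 / (1 - q ^ L i)) * (\<Prod>j=1..m'. 1 / q ^ (j - 1)) * det1 m (\<lambda>i j. y j ^ L i)"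
    proof -
      let ?F = "\<lambda>i j. if j < m then y j ^ L i - 1 * y (Suc j) ^ L i else y j ^ L i"
      \<comment> \<open>For an empty last row all exponents in it are 0: the differences vanish and
        the final entry is 1, so expansion along this row removes it without a factor.\<close>
      have "det1 m' ?F = det1 m ?F"
      proof (cases "m' = m")
        case False
        with m' have "m = Suc m'" "L (Suc m') = 0" by auto
        then show ?thesis
          using det1_last_row[of m' ?F] by simp
      qed simp
      also have "\<dots> = det1 m (\<lambda>i j. y j ^ L i)"
        by (rule det1_col_ops)
      finally show ?thesis
        by (simp only: det1_scale)
    qed
    finally have "((\<lambda>e'. det1 m' (\<lambda>i j. q ^ e' j * (q ^ (e' j + (j - 1))) ^ (L i - 1)) * (1 / ?C m' L')) has_sum
        (\<Prod>i=1..m'. 1 / (1 - q ^ L i)) * (\<Prod>j=1..m'. 1 / q ^ (j - 1)) * det1 m (\<lambda>i j. y j ^ L i) *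
        (1 / ?C m' L')) ?I"
      by (rule has_sum_cmult_left)
    also have "(\<lambda>e'. det1 m' (\<lambda>i j. q ^ e' j * (q ^ (e' j + (j - 1))) ^ (L i - 1)) * (1 / ?C m' L')) =
        (\<lambda>e'. q ^ (\<Sum>j=1..m'. e' j) * (det1 m' (\<lambda>i j. (q ^ (e' j + (j - 1))) ^ L' i) / ?C m' L'))"
    proof
      fix e'
      show "det1 m' (\<lambda>i j. q ^ e' j * (q ^ (e' j + (j - 1))) ^ (L i - 1)) * (1 / ?C m' L') =
        q ^ (\<Sum>j=1..m'. e' j) * (det1 m' (\<lambda>i j. (q ^ (e' j + (j - 1))) ^ L' i) / ?C m' L')"
        using det1_scale[of m' "\<lambda>_. 1" "\<lambda>j. q ^ e' j" "\<lambda>i j. (q ^ (e' j + (j - 1))) ^ (L i - 1)"]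
        by (simp add: L'_def power_sum)
    qed
    also have "(\<Prod>i=1..m'. 1 / (1 - q ^ L i)) * (\<Prod>j=1..m'. 1 / q ^ (j - 1)) * det1 m (\<lambda>i j. y j ^ L i) *
        (1 / ?C m' L') = det1 m (\<lambda>i j. y j ^ L i) / ?C m L"
    proof -
      have "(\<Sum>i=1..m. (i - 1) * L i) = (\<Sum>i=1..m'. (i - 1) * L i)"
        using m' by auto
      also have "\<dots> = (\<Sum>i=1..m'. (i - 1) * L' i + (i - 1))"
      proof (rule sum.cong)
        fix i assume "i \<in> {1..m'}"
        then show "(i - 1) * L i = (i - 1) * L' i + (i - 1)"
          using pos[of i] by (cases "L i") (auto simp: L'_def)
      qed simp
      finally have 1: "q ^ (\<Sum>i=1..m. (i - 1) * L i) =
          q ^ (\<Sum>i=1..m'. (i - 1) * L' i) * (\<Prod>j=1..m'. q ^ (j - 1))"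
        by (simp only: sum.distrib power_add power_sum)
      have "(\<Prod>i=1..m. qq_poch q (L i)) = (\<Prod>i=1..m'. qq_poch q (L i))"
        using m' by (auto simp: qq_poch_def)
      also have "\<dots> = (\<Prod>i=1..m'. qq_poch q (L' i) * (1 - q ^ L i))"
      proof (rule prod.cong)
        fix i assume "i \<in> {1..m'}"
        then show "qq_poch q (L i) = qq_poch q (L' i) * (1 - q ^ L i)"
          using pos[of i] by (cases "L i") (auto simp: L'_def qq_poch_def)
      qed simp
      finally have 2: "(\<Prod>i=1..m. qq_poch q (L i)) = (\<Prod>i=1..m'. qq_poch q (L' i)) * (\<Prod>i=1..m'. 1 - q ^ L i)"
        by (simp add: prod.distrib)
      show ?thesis
        unfolding 1 2 prod_dividef by (simp add: mult_ac)
    qed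
    finally have outer: "((\<lambda>e'. q ^ (\<Sum>j=1..m'. e' j) *
        (det1 m' (\<lambda>i j. (q ^ (e' j + (j - 1))) ^ L' i) / ?C m' L')) has_sum
        det1 m (\<lambda>i j. y j ^ L i) / ?C m L) ?I" .
    have inner': "((\<lambda>T. case (e', T) of (e', T) \<Rightarrow> q ^ (\<Sum>j=1..m'. e' j) * q ^ half_size m' L' T) has_sum
        q ^ (\<Sum>j=1..m'. e' j) * (det1 m' (\<lambda>i j. (q ^ (e' j + (j - 1))) ^ L' i) / ?C m' L')) (half_RPP m' L' e')"
      if "e' \<in> ?I" for e'
      using has_sum_cmult_right[OF inner[OF that]] by simp
    \<comment> \<open>The terms are nonnegative, so convergence of the iterated sum gives
      summability on the dependent product.\<close>
    have "(\<lambda>(e', T). q ^ (\<Sum>j=1..m'. e' j) * q ^ half_size m' L' T) summable_on Sigma ?I (half_RPP m' L')"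
      using inner' by (rule summable_on_SigmaI) (use outer q in \<open>auto simp: summable_on_def\<close>)
    then have "((\<lambda>(e', T). q ^ (\<Sum>j=1..m'. e' j) * q ^ half_size m' L' T) has_sum
        det1 m (\<lambda>i j. y j ^ L i) / ?C m L) (Sigma ?I (half_RPP m' L'))"
      using inner' outer by (intro has_sum_SigmaI)
    then show ?thesis
      unfolding L'_def y_def
      by (subst has_sum_half_RPP_peel[where L = L and m = m and m' = m'])
         (use m' pos less.prems(2) in simp_all)
  qed
qed

section \<open>Splitting a reverse plane partition along its diagonal\<close>

lemma le_conjugate_iff:
  assumes \<mu>: "partition_parts_le n \<mu>" and "1 \<le> c" "1 \<le> j"
  shows "j \<le> Defs.conjugate \<mu> c \<longleftrightarrow> c \<le> \<mu> j"
proof -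
  have "{i. 1 \<le> i \<and> c \<le> \<mu> i} = {1..Defs.conjugate \<mu> c}"
    unfolding Defs.conjugate_def
  proof (rule initial_segment_eq[of _ n])
    show "{i. 1 \<le> i \<and> c \<le> \<mu> i} \<subseteq> {1..n}"
    proof
      fix i assume "i \<in> {i. 1 \<le> i \<and> c \<le> \<mu> i}"
      then show "i \<in> {1..n}"
        using \<mu> \<open>1 \<le> c\<close> by (cases "i \<le> n") (auto simp: partition_parts_le_def)
    qed
  next
    fix j j' assume *: "j \<in> {i. 1 \<le> i \<and> c \<le> \<mu> i}" "1 \<le> j'" "j' \<le> j"
    then show "j' \<in> {i. 1 \<le> i \<and> c \<le> \<mu> i}"
      using partition_parts_le_antimono[OF \<mu>, of j' j] by simp
  qed
  then have "j \<in> {i. 1 \<le> i \<and> c \<le> \<mu> i} \<longleftrightarrow> j \<in> {1..Defs.conjugate \<mu> c}"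
    by simp
  then show ?thesis
    using \<open>1 \<le> j\<close> by simp
qed

text \<open>A description that treats rows and columns alike: on or above the diagonal a cell is
  bounded by \<open>\<kappa>\<close> along its row, on or below it by \<open>\<mu>\<close> along its
  column. On the diagonal both conditions reduce to \<open>i \<le> n\<close>.\<close>

lemma mem_young_attached_shape:
  assumes \<mu>: "partition_parts_le n \<mu>"
  shows "(i, j) \<in> young_diagram (attached_shape n \<kappa> \<mu>) \<longleftrightarrow>
    1 \<le> i \<and> 1 \<le> j \<and> (i \<le> j \<longrightarrow> i \<le> n \<and> j \<le> \<kappa> i + n) \<and> (j \<le> i \<longrightarrow> j \<le> n \<and> i \<le> \<mu> j + n)"
proof (cases "i \<le> n")
  case True
  then show ?thesis
    by (auto simp: young_diagram_def attached_shape_def)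
next
  case False
  have "\<mu> j = 0" if "j > n"
    using that \<mu> by (simp add: partition_parts_le_def)
  moreover have "j \<le> Defs.conjugate \<mu> (i - n) \<longleftrightarrow> i - n \<le> \<mu> j" if "1 \<le> j"
    using False that by (intro le_conjugate_iff[OF \<mu>]) auto
  ultimately show ?thesis
    using False
    by (cases "j \<le> n") (auto simp: young_diagram_def attached_shape_def)
qed

text \<open>Comparisons of neighbours chain together because the cells between two cells belong to
  the diagram. Along rows this is automatic; along columns it is what \<open>up\<close>
  provides.\<close>

lemma RPPI_local:
  assumes out: "\<And>i j. (i, j) \<notin> young_diagram \<kappa> \<Longrightarrow> T i j = 0"
    and row: "\<And>i j. (i, j) \<in> young_diagram \<kappa> \<Longrightarrow> (i, Suc j) \<in> young_diagram \<kappa> \<Longrightarrow> T i j \<le> T i (Suc j)"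
    and column: "\<And>i j. (i, j) \<in> young_diagram \<kappa> \<Longrightarrow> (Suc i, j) \<in> young_diagram \<kappa> \<Longrightarrow> T i j \<le> T (Suc i) j"
    and up: "\<And>i k j. (i, j) \<in> young_diagram \<kappa> \<Longrightarrow> 1 \<le> k \<Longrightarrow> k \<le> i \<Longrightarrow> (k, j) \<in> young_diagram \<kappa>"
  shows "T \<in> RPP \<kappa>"
proof -
  have "T i j \<le> T i j'"
    if "j \<le> j'" "(i, j) \<in> young_diagram \<kappa>" "(i, j') \<in> young_diagram \<kappa>" for i j j'
    using that
  proof (induction rule: dec_induct)
    case (step k)
    then have "(i, k) \<in> young_diagram \<kappa>"
      by (auto simp: young_diagram_def)
    with step row[of i k] show ?case by simp
  qed simp
  moreover have "T i j \<le> T i' j"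
    if "i \<le> i'" "(i, j) \<in> young_diagram \<kappa>" "(i', j) \<in> young_diagram \<kappa>" for i i' j
    using that
  proof (induction rule: dec_induct)
    case (step k)
    then have "(k, j) \<in> young_diagram \<kappa>"
      using up[of "Suc k" j k] by (auto simp: young_diagram_def)
    with step column[of k j] show ?case by simp
  qed simp
  ultimately show ?thesis
    using out by (simp add: RPP_def)
qed

text \<open>A filling is cut into its diagonal and the parts above and below, each indexed by the
  distance from the diagonal. A diagonal entry counts in the size and in the trace, hence the weight
  \<open>q * t\<close>; all others count in the size only.\<close>

lemma has_sum_RPP_attached_shape:
  fixes q t :: real
  assumes \<kappa>: "partition_parts_le n \<kappa>" and \<mu>: "partition_parts_le n \<mu>"
  defines "\<nu> \<equiv> attached_shape n \<kappa> \<mu>"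
  defines "L \<equiv> \<lambda>i. \<kappa> i + n - i" and "M \<equiv> \<lambda>i. \<mu> i + n - i"
  shows "((\<lambda>T. q ^ rpp_size \<nu> T * t ^ rpp_trace n T) has_sum S) (RPP \<nu>) \<longleftrightarrow>
    ((\<lambda>(d, U, V). (q * t) ^ (\<Sum>i=1..n. d i) * (q ^ half_size n L U * q ^ half_size n M V)) has_sum S)
      (Sigma (increasing_diagonals n) (\<lambda>d. half_RPP n L d \<times> half_RPP n M d))"
proof (rule has_sum_reindex_bij_witness[
      where j = "\<lambda>T. (\<lambda>i. T i i, \<lambda>i c. T i (i + c), \<lambda>i c. T (i + c) i)"
        and i = "\<lambda>(d, U, V) i j. if i \<le> j then U i (j - i) else V j (i - j)"])
  note mem = mem_young_attached_shape[OF \<mu>, of _ _ \<kappa>, folded \<nu>_def]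
  have L: "L (Suc i) < L i" if "1 \<le> i" "i < n" for i
    using partition_parts_le_antimono[OF \<kappa>, of i "Suc i"] that by (simp add: L_def)
  have M: "M (Suc i) < M i" if "1 \<le> i" "i < n" for i
    using partition_parts_le_antimono[OF \<mu>, of i "Suc i"] that by (simp add: M_def)
  have upper: "(i, i + c) \<in> young_diagram \<nu> \<longleftrightarrow> 1 \<le> i \<and> i \<le> n \<and> c \<le> L i" for i c
    unfolding mem L_def by (cases "c = 0") auto
  have lower: "(i + c, i) \<in> young_diagram \<nu> \<longleftrightarrow> 1 \<le> i \<and> i \<le> n \<and> c \<le> M i" for i c
    unfolding mem M_def by (cases "c = 0") auto
  have diagonal: "(i, i) \<in> young_diagram \<nu> \<longleftrightarrow> 1 \<le> i \<and> i \<le> n" for i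
    using upper[of i 0] by simp
  {
    fix T assume T: "T \<in> RPP \<nu>"
    have out: "T i j = 0" if "(i, j) \<notin> young_diagram \<nu>" for i j
      using T that by (simp add: RPP_def)
    have row: "T i j \<le> T i (Suc j)" if "(i, j) \<in> young_diagram \<nu>" "(i, Suc j) \<in> young_diagram \<nu>" for i j
      using T that by (simp add: RPP_def)
    have column: "T i j \<le> T (Suc i) j" if "(i, j) \<in> young_diagram \<nu>" "(Suc i, j) \<in> young_diagram \<nu>" for i j
      using T that by (simp add: RPP_def)
    have U: "(\<lambda>i c. T i (i + c)) \<in> half_RPP n L (\<lambda>i. T i i)"
    proof (rule half_RPPI)
      fix i c assume "\<not> (1 \<le> i \<and> i \<le> n \<and> c \<le> L i)"
      then show "T i (i + c) = 0"
        using out upper by blast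
    next
      fix i c assume "1 \<le> i" "i \<le> n" "c < L i"
      then show "T i (i + c) \<le> T i (i + Suc c)"
        using row[of i "i + c"] upper[of i c] upper[of i "Suc c"] by simp
    next
      fix i c assume "1 \<le> i" "i < n" "c \<le> L (Suc i)"
      then show "T i (i + Suc c) \<le> T (Suc i) (Suc i + c)"
        using column[of i "i + Suc c"] upper[of i "Suc c"] upper[of "Suc i" c] L[of i] by simp
    qed simp
    have V: "(\<lambda>i c. T (i + c) i) \<in> half_RPP n M (\<lambda>i. T i i)"
    proof (rule half_RPPI)
      fix i c assume "\<not> (1 \<le> i \<and> i \<le> n \<and> c \<le> M i)"
      then show "T (i + c) i = 0"
        using out lower by blast
    next
      fix i c assume "1 \<le> i" "i \<le> n" "c < M i"
      then show "T (i + c) i \<le> T (i + Suc c) i"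
        using column[of "i + c" i] lower[of i c] lower[of i "Suc c"] by simp
    next
      fix i c assume "1 \<le> i" "i < n" "c \<le> M (Suc i)"
      then show "T (i + Suc c) i \<le> T (Suc i + c) (Suc i)"
        using row[of "i + Suc c" i] lower[of i "Suc c"] lower[of "Suc i" c] M[of i] by simp
    qed simp
    \<comment> \<open>A diagonal step passes through the cell \<open>(i, Suc i)\<close>, which
      exists because \<open>L i\<close> is positive for \<open>i < n\<close>.\<close>
    have "(\<lambda>i. T i i) \<in> increasing_diagonals n"
      unfolding increasing_diagonals_def mem_Collect_eq
    proof (intro conjI allI impI; (elim conjE)?)
      fix i assume "1 \<le> i" "i < n"
      then show "T i i \<le> T (Suc i) (Suc i)"
        using half_RPP_row[OF U, of i 0] half_RPP_column[OF U, of i 0] L[of i] by simp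
    next
      fix i assume "i \<notin> {1..n}"
      then show "T i i = 0"
        using half_RPP_outside[OF U, of i 0] by simp
    qed
    with U V show "(\<lambda>i. T i i, \<lambda>i c. T i (i + c), \<lambda>i c. T (i + c) i)
        \<in> Sigma (increasing_diagonals n) (\<lambda>d. half_RPP n L d \<times> half_RPP n M d)"
      by simp
    show "(case (\<lambda>i. T i i, \<lambda>i c. T i (i + c), \<lambda>i c. T (i + c) i) of
        (d, U, V) \<Rightarrow> \<lambda>i j. if i \<le> j then U i (j - i) else V j (i - j)) = T"
      by (auto simp: fun_eq_iff)
    have "rpp_size \<nu> T = (\<Sum>i=1..n. T i i) + half_size n L (\<lambda>i c. T i (i + c)) + half_size n M (\<lambda>i c. T (i + c) i)"
    proof -
      let ?f = "\<lambda>(i, j). T i j"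
      let ?A = "(\<lambda>i. (i, i)) ` {1..n}"
      let ?B = "(\<lambda>(i, c). (i, i + c)) ` Sigma {1..n} (\<lambda>i. {1..L i})"
      let ?C = "(\<lambda>(i, c). (i + c, i)) ` Sigma {1..n} (\<lambda>i. {1..M i})"
      have "young_diagram \<nu> = ?A \<union> ?B \<union> ?C"
      proof (intro subset_antisym subrelI)
        fix i j assume ij: "(i, j) \<in> young_diagram \<nu>"
        consider "i = j" | c where "j = i + c" "1 \<le> c" | c where "i = j + c" "1 \<le> c"
          using less_imp_Suc_add[of i j] less_imp_Suc_add[of j i] by (cases i j rule: linorder_cases) auto
        then show "(i, j) \<in> ?A \<union> ?B \<union> ?C"
        proof cases
          case 1
          with ij upper[of i 0] show ?thesis by auto
        next
          case (2 c)
          with ij upper[of i c] have "(i, c) \<in> Sigma {1..n} (\<lambda>i. {1..L i})" by simp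
          with 2 show ?thesis by (auto intro: image_eqI[where x = "(i, c)"])
        next
          case (3 c)
          with ij lower[of j c] have "(j, c) \<in> Sigma {1..n} (\<lambda>i. {1..M i})" by simp
          with 3 show ?thesis by (auto intro: image_eqI[where x = "(j, c)"])
        qed
      next
        fix i j assume "(i, j) \<in> ?A \<union> ?B \<union> ?C"
        then show "(i, j) \<in> young_diagram \<nu>"
          by (auto simp: upper lower diagonal)
      qed
      moreover have "?A \<inter> ?B = {}" "(?A \<union> ?B) \<inter> ?C = {}"
        by auto
      ultimately have "rpp_size \<nu> T = sum ?f ?A + sum ?f ?B + sum ?f ?C"
        unfolding rpp_size_def by (simp add: sum.union_disjoint)
      also have "sum ?f ?A = (\<Sum>i=1..n. T i i)"
        by (subst sum.reindex) (auto simp: inj_on_def)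
      also have "sum ?f ?B = half_size n L (\<lambda>i c. T i (i + c))"
        unfolding half_size_def
        by (subst sum.reindex) (auto simp: inj_on_def sum.Sigma intro!: sum.cong)
      also have "sum ?f ?C = half_size n M (\<lambda>i c. T (i + c) i)"
        unfolding half_size_def
        by (subst sum.reindex) (auto simp: inj_on_def sum.Sigma intro!: sum.cong)
      finally show ?thesis .
    qed
    then show "(case (\<lambda>i. T i i, \<lambda>i c. T i (i + c), \<lambda>i c. T (i + c) i) of
        (d, U, V) \<Rightarrow> (q * t) ^ (\<Sum>i=1..n. d i) * (q ^ half_size n L U * q ^ half_size n M V)) =
        q ^ rpp_size \<nu> T * t ^ rpp_trace n T"
      by (simp add: power_add power_mult_distrib rpp_trace_def mult_ac)
  }
  fix p assume "p \<in> Sigma (increasing_diagonals n) (\<lambda>d. half_RPP n L d \<times> half_RPP n M d)"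
  then obtain d U V where p: "p = (d, U, V)" and U: "U \<in> half_RPP n L d" and V: "V \<in> half_RPP n M d"
    by auto
  let ?T = "\<lambda>i j. if i \<le> j then U i (j - i) else V j (i - j)"
  note diag = half_RPP_diag[OF U] half_RPP_diag[OF V]
  show "(\<lambda>i. (case p of (d, U, V) \<Rightarrow> \<lambda>i j. if i \<le> j then U i (j - i) else V j (i - j)) i i,
      \<lambda>i c. (case p of (d, U, V) \<Rightarrow> \<lambda>i j. if i \<le> j then U i (j - i) else V j (i - j)) i (i + c),
      \<lambda>i c. (case p of (d, U, V) \<Rightarrow> \<lambda>i j. if i \<le> j then U i (j - i) else V j (i - j)) (i + c) i) = p"
    using diag by (auto simp: p fun_eq_iff)
  have "?T \<in> RPP \<nu>"
  proof (rule RPPI_local)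
    fix i j assume ij: "(i, j) \<notin> young_diagram \<nu>"
    show "?T i j = 0"
    proof (cases "i \<le> j")
      case True
      then show ?thesis
        using ij upper[of i "j - i"] half_RPP_outside[OF U, of i "j - i"] by simp
    next
      case False
      then show ?thesis
        using ij lower[of j "i - j"] half_RPP_outside[OF V, of j "i - j"] by simp
    qed
  next
    fix i j assume ij: "(i, j) \<in> young_diagram \<nu>" "(i, Suc j) \<in> young_diagram \<nu>"
    show "?T i j \<le> ?T i (Suc j)"
    proof (cases "i \<le> j")
      case True
      then show ?thesis
        using ij upper[of i "Suc (j - i)"] half_RPP_row[OF U, of i "j - i"] by (simp add: Suc_diff_le)
    next
      case False
      then obtain c where c: "i = Suc (j + c)"
        using less_imp_Suc_add not_le by blast
      have "1 \<le> j \<and> j < n \<and> c \<le> M (Suc j)"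
        using ij lower[of j "Suc c"] lower[of "Suc j" c] c by simp
      \<comment> \<open>Below the diagonal a step to the right comes closer to it by one, which is
        the column condition of \<open>V\<close>. For \<open>c = 0\<close> the right cell lies on
        the diagonal, where \<open>?T\<close> reads \<open>U\<close>; there both halves agree with
        \<open>d\<close>.\<close>
      then have "V j (Suc c) \<le> V (Suc j) c"
        using half_RPP_column[OF V, of j c] by simp
      then show ?thesis
        using c diag by (cases "c = 0") auto
    qed
  next
    fix i j assume ij: "(i, j) \<in> young_diagram \<nu>" "(Suc i, j) \<in> young_diagram \<nu>"
    show "?T i j \<le> ?T (Suc i) j"
    proof (cases "Suc i \<le> j")
      case True
      then obtain c where c: "j = Suc (i + c)"
        using less_imp_Suc_add Suc_le_eq by blast
      have "1 \<le> i \<and> i < n \<and> c \<le> L (Suc i)"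
        using ij upper[of i "Suc c"] upper[of "Suc i" c] c by simp
      then have "U i (Suc c) \<le> U (Suc i) c"
        using half_RPP_column[OF U, of i c] by simp
      then show ?thesis
        using c by simp
    next
      case False
      then obtain c where c: "i = j + c"
        using le_Suc_ex not_less_eq_eq by blast
      have "V j c \<le> V j (Suc c)"
        using ij lower[of j "Suc c"] half_RPP_row[OF V, of j c] c by simp
      then show ?thesis
        using c diag by (cases "c = 0") auto
    qed
  next
    fix i k j assume "(i, j) \<in> young_diagram \<nu>" "1 \<le> k" "k \<le> i"
    then show "(k, j) \<in> young_diagram \<nu>"
      using partition_parts_le_antimono[OF \<kappa>, of k i] unfolding mem by auto
  qed
  then show "(case p of (d, U, V) \<Rightarrow> \<lambda>i j. if i \<le> j then U i (j - i) else V j (i - j)) \<in> RPP \<nu>"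
    by (simp add: p)
qed simp

section \<open>The iterated q-integral\<close>

text \<open>The exponents of the nodes \<open>x i = q ^ u i\<close> of the integral up to
  \<open>q ^ N\<close>. As \<open>q < 1\<close>, increasing nodes have decreasing exponents and the
  upper limit becomes the lower bound \<open>N\<close>.\<close>

definition exponent_chains :: "nat \<Rightarrow> nat \<Rightarrow> (nat \<Rightarrow> nat) set" where
  "exponent_chains m N = {u. (\<forall>i. i \<notin> {1..m} \<longrightarrow> u i = 0) \<and> (\<forall>i\<in>{1..m}. N \<le> u i) \<and>
     (\<forall>i j. 1 \<le> i \<and> i \<le> j \<and> j \<le> m \<longrightarrow> u j \<le> u i)}"

text \<open>The value 0 outside \<open>{1..m}\<close> reproduces the initial point that
  \<open>simplex_q_integral\<close> overwrites.\<close>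

definition power_point :: "real \<Rightarrow> nat \<Rightarrow> (nat \<Rightarrow> nat) \<Rightarrow> nat \<Rightarrow> real" where
  "power_point q m u i = (if i \<in> {1..m} then q ^ u i else 0)"

lemma power_point_upd: "power_point q (Suc m) (u(Suc m := k)) = (power_point q m u)(Suc m := q ^ k)"
  by (auto simp: power_point_def fun_eq_iff le_Suc_eq)

text \<open>The outermost variable is \<open>q ^ k\<close> with \<open>k \<ge> N\<close> and the
  rest is an integral up to \<open>q ^ k\<close>, so all nested limits stay powers of
  \<open>q\<close>; the lower limit 0 contributes nothing. Summability of the whole family
  identifies the ordered iterated series with one unordered sum.\<close>

lemma simplex_q_integral_eq_has_sum:
  assumes q: "0 < q" "q < 1"
    and "((\<lambda>u. f (power_point q m u) * (\<Prod>i=1..m. q ^ u i)) has_sum S) (exponent_chains m N)"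
  shows "simplex_q_integral q m (q ^ N) f = (1 - q) ^ m * S"
  using assms(3)
proof (induction m arbitrary: f S N)
  case 0
  have chains: "exponent_chains 0 N = {\<lambda>_. 0}"
    by (auto simp: exponent_chains_def)
  have pp: "power_point q 0 (\<lambda>_. 0) = (\<lambda>_. 0)"
    by (auto simp: power_point_def fun_eq_iff)
  show ?case
    using infsumI[OF 0] unfolding chains by (simp add: pp)
next
  case (Suc m)
  define f' where "f' = (\<lambda>k x. f (x(Suc m := q ^ k)))"
  define F where "F = (\<lambda>k u. f' k (power_point q m u) * (\<Prod>i=1..m. q ^ u i))"
  have "((\<lambda>u. f (power_point q (Suc m) u) * (\<Prod>i=1..Suc m. q ^ u i)) has_sum S) (exponent_chains (Suc m) N)
      \<longleftrightarrow> ((\<lambda>(k, u). q ^ k * F k u) has_sum S) (Sigma {N..} (exponent_chains m))"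
  proof (rule has_sum_reindex_bij_witness[where j = "\<lambda>u. (u (Suc m), u(Suc m := 0))"
        and i = "\<lambda>(k, u). u(Suc m := k)"])
    fix u assume u: "u \<in> exponent_chains (Suc m) N"
    show "(u (Suc m), u(Suc m := 0)) \<in> Sigma {N..} (exponent_chains m)"
      using u by (auto simp: exponent_chains_def)
    have "u = (u(Suc m := 0))(Suc m := u (Suc m))"
      by simp
    then have "power_point q (Suc m) u = (power_point q m (u(Suc m := 0)))(Suc m := q ^ u (Suc m))"
      by (metis power_point_upd)
    then show "(case (u (Suc m), u(Suc m := 0)) of (k, u) \<Rightarrow> q ^ k * F k u) =
        f (power_point q (Suc m) u) * (\<Prod>i=1..Suc m. q ^ u i)"
      by (simp add: F_def f'_def)
  next
    fix p assume p: "p \<in> Sigma {N..} (exponent_chains m)"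
    obtain k u where ku: "p = (k, u)" by (cases p)
    then have u: "N \<le> k" "u \<in> exponent_chains m k"
      using p by auto
    show "((case p of (k, u) \<Rightarrow> u(Suc m := k)) (Suc m), (case p of (k, u) \<Rightarrow> u(Suc m := k))(Suc m := 0)) = p"
      using u by (auto simp: ku exponent_chains_def fun_eq_iff)
    show "(case p of (k, u) \<Rightarrow> u(Suc m := k)) \<in> exponent_chains (Suc m) N"
      using u unfolding ku prod.case exponent_chains_def mem_Collect_eq
      by (auto simp: le_Suc_eq) (meson atLeastAtMost_iff le_trans One_nat_def)+
  qed auto
  then have S: "((\<lambda>(k, u). q ^ k * F k u) has_sum S) (Sigma {N..} (exponent_chains m))"
    using Suc.prems by simp
  \<comment> \<open>The inner sums converge as slices of the summable family, after division by the
    nonzero \<open>q ^ k\<close>.\<close>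
  have F: "(F k has_sum infsum (F k) (exponent_chains m k)) (exponent_chains m k)" if "k \<in> {N..}" for k
  proof -
    have "(\<lambda>u. q ^ k * F k u) summable_on exponent_chains m k"
      using S that by (intro summable_on_SigmaD1[where A = "{N..}" and f = "\<lambda>k u. q ^ k * F k u"])
        (auto simp: summable_on_def)
    then have "F k summable_on exponent_chains m k"
      using q by (subst (asm) summable_on_cmult_right') auto
    then show ?thesis by simp
  qed
  have simplex: "simplex_q_integral q m (q ^ k) (f' k) = (1 - q) ^ m * infsum (F k) (exponent_chains m k)"
    if "k \<in> {N..}" for k
    using F[OF that] unfolding F_def by (rule Suc.IH)
  have "((\<lambda>k. q ^ k * infsum (F k) (exponent_chains m k)) has_sum S) {N..}"
    by (rule has_sum_SigmaD[OF S]) (auto intro: has_sum_cmult_right F)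
  then have "((\<lambda>k. (1 - q) ^ m * (q ^ k * infsum (F k) (exponent_chains m k))) has_sum ((1 - q) ^ m * S)) {N..}"
    by (rule has_sum_cmult_right)
  then have "((\<lambda>i. simplex_q_integral q m (q ^ (N + i)) (f' (N + i)) * q ^ (N + i)) has_sum ((1 - q) ^ m * S)) UNIV"
    by (subst has_sum_reindex_bij_witness[where j = "\<lambda>i. N + i" and i = "\<lambda>k. k - N" and T = "{N..}"
          and h = "\<lambda>k. (1 - q) ^ m * (q ^ k * infsum (F k) (exponent_chains m k))"])
       (auto simp: simplex)
  then have "(\<Sum>i. simplex_q_integral q m (q ^ (N + i)) (f' (N + i)) * q ^ (N + i)) = (1 - q) ^ m * S"
    by (metis has_sum_imp_sums sums_unique)
  then show ?case
    by (simp add: q_integral_def f'_def power_add)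
qed

definition strict_chains :: "nat \<Rightarrow> (nat \<Rightarrow> nat) set" where
  "strict_chains n = {u \<in> exponent_chains n 0. \<forall>i. 1 \<le> i \<and> i < n \<longrightarrow> u (Suc i) < u i}"

text \<open>
  The index reversal is forced by the integration variables being increasing while the
  exponents \<open>d\<^sub>j + j - 1\<close> of the diagonal increase too.
\<close>

lemma has_sum_strict_chains:
  "((\<lambda>d. F (\<lambda>i. if i \<in> {1..n} then d (Suc n - i) + (n - i) else 0)) has_sum S) (increasing_diagonals n) \<longleftrightarrow>
    (F has_sum S) (strict_chains n)"
proof (rule has_sum_reindex_bij_witness[
      where j = "\<lambda>d i. if i \<in> {1..n} then d (Suc n - i) + (n - i) else 0"
        and i = "\<lambda>u j. if j \<in> {1..n} then u (Suc n - j) - (j - 1) else 0"])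
  fix d assume d: "d \<in> increasing_diagonals n"
  have mono: "d i \<le> d j" if "i \<le> j" "1 \<le> i" "j \<le> n" for i j
    using that
  proof (induction rule: dec_induct)
    case (step k)
    then have "d k \<le> d (Suc k)"
      using d by (simp add: increasing_diagonals_def)
    with step show ?case by simp
  qed simp
  let ?u = "\<lambda>i. if i \<in> {1..n} then d (Suc n - i) + (n - i) else 0"
  show "(\<lambda>j. if j \<in> {1..n} then ?u (Suc n - j) - (j - 1) else 0) = d"
    using d by (auto simp: increasing_diagonals_def fun_eq_iff)
  have "?u (Suc i) < ?u i" if "1 \<le> i" "i < n" for i
  proof -
    have "d (n - i) \<le> d (Suc n - i)"
      using that by (intro mono) auto
    with that show ?thesis by auto
  qed
  moreover have "?u j \<le> ?u i" if "1 \<le> i" "i \<le> j" "j \<le> n" for i j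
  proof -
    have "d (Suc n - j) \<le> d (Suc n - i)"
      using that by (intro mono) auto
    with that show ?thesis by auto
  qed
  ultimately show "?u \<in> strict_chains n"
    by (auto simp: strict_chains_def exponent_chains_def)
next
  fix u assume u: "u \<in> strict_chains n"
  have step: "u (Suc i) < u i" if "1 \<le> i" "i < n" for i
    using u that by (simp add: strict_chains_def)
  \<comment> \<open>Strict descent to \<open>u n \<ge> 0\<close> keeps the truncated subtraction
    \<open>u (Suc n - j) - (j - 1)\<close> exact.\<close>
  have ge: "n - i \<le> u i" if "i \<le> n" "1 \<le> i" for i
    using that
  proof (induction rule: inc_induct)
    case (step k)
    then show ?case
      using u by (force simp: strict_chains_def)
  qed simp
  let ?d = "\<lambda>j. if j \<in> {1..n} then u (Suc n - j) - (j - 1) else 0"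
  have zero: "u i = 0" if "i \<notin> {1..n}" for i
    using u that by (simp add: strict_chains_def exponent_chains_def)
  show "(\<lambda>i. if i \<in> {1..n} then ?d (Suc n - i) + (n - i) else 0) = u"
  proof
    fix i
    show "(if i \<in> {1..n} then ?d (Suc n - i) + (n - i) else 0) = u i"
      using zero[of i] ge[of i] by auto
  qed
  have "?d i \<le> ?d (Suc i)" if "1 \<le> i" "i < n" for i
  proof -
    have "u (Suc (n - i)) < u (n - i)"
      using that by (intro step) auto
    with that show ?thesis
      by (auto simp: Suc_diff_le)
  qed
  then show "?d \<in> increasing_diagonals n"
    by (auto simp: increasing_diagonals_def)
qed auto

section \<open>Comparison of both sides\<close>

text \<open>Reconciles the sign convention of \<open>vandermonde\<close> with that of the
  bialternant formula.\<close>

lemma vandermonde_square: "(vandermonde n x)\<^sup>2 = (\<Prod>j=1..n. \<Prod>i=1..<j. x i - x j)\<^sup>2"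
  unfolding vandermonde_def prod_power_distrib by (intro prod.cong refl power2_commute)

lemma sum_choose_2: "(\<Sum>i=1..n. i - 1) = n choose 2"
proof -
  have "(\<Sum>i=1..n. i - 1) = \<Sum>{0..<n}"
    by (rule sum.reindex_bij_witness[where i = Suc and j = "\<lambda>i. i - 1"]) auto
  then show ?thesis
    by (simp add: choose_two Sum_Ico_nat)
qed

text \<open>In row \<open>i \<le> n\<close> the staircase adds \<open>n + 1 - i\<close>, one more
  than the \<open>n - i\<close> in the exponents of the alternant; the excess sums to
  \<open>n choose 2\<close>. Truncated subtraction leaves nothing beyond row
  \<open>n\<close>.\<close>

lemma b_stat_staircase:
  assumes "partition_parts_le n \<kappa>"
  shows "b_stat (\<lambda>i. staircase (n + 1) i + \<kappa> i) = (\<Sum>i=1..n. (i - 1) * (\<kappa> i + n - i)) + (n choose 2)"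
proof -
  have "i \<le> n" if "0 < staircase (n + 1) i + \<kappa> i" for i
    using that assms by (cases "i \<le> n") (auto simp: staircase_def partition_parts_le_def)
  then have "{i. 1 \<le> i \<and> staircase (n + 1) i + \<kappa> i \<noteq> 0} = {1..n}"
    by (auto simp: staircase_def)
  then have "b_stat (\<lambda>i. staircase (n + 1) i + \<kappa> i) = (\<Sum>i=1..n. (i - 1) * (staircase (n + 1) i + \<kappa> i))"
    by (simp only: b_stat_def)
  also have "\<dots> = (\<Sum>i=1..n. (i - 1) * (\<kappa> i + n - i) + (i - 1))"
  proof (rule sum.cong)
    fix i assume "i \<in> {1..n}"
    then have "staircase (n + 1) i + \<kappa> i = Suc (\<kappa> i + n - i)"
      unfolding staircase_def atLeastAtMost_iff by arith
    then show "(i - 1) * (staircase (n + 1) i + \<kappa> i) = (i - 1) * (\<kappa> i + n - i) + (i - 1)"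
      by simp
  qed simp
  finally show ?thesis
    by (simp only: sum.distrib sum_choose_2)
qed

text \<open>Comparison with a product of \<open>n\<close> geometric series over all tuples, of which
  the increasing ones form a subset.\<close>

lemma summable_on_increasing_diagonals:
  fixes F :: "(nat \<Rightarrow> nat) \<Rightarrow> real"
  assumes t: "0 < t" "t < 1" and bound: "\<And>d. \<bar>F d\<bar> \<le> B"
  shows "(\<lambda>d. t ^ (\<Sum>i=1..n. d i) * F d) summable_on increasing_diagonals n"
  unfolding summable_on_iff_abs_summable_on_real[of "\<lambda>d. t ^ (\<Sum>i=1..n. d i) * F d"]
proof (rule Infinite_Sum.abs_summable_on_comparison_test')
  have "((\<lambda>i. t ^ i) has_sum 1 / (1 - t)) UNIV"
    using geometric_sums[of t] t
    by (intro norm_summable_imp_has_sum) (auto simp: summable_geometric_iff)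
  then have "((\<lambda>d. \<Prod>i=1..n. t ^ d i) has_sum (\<Prod>i=1..n. 1 / (1 - t))) (zero_PiE {1..n} (\<lambda>_. UNIV))"
    by (intro has_sum_prod_zero_PiE) auto
  then have "(\<lambda>d. \<Prod>i=1..n. t ^ d i) summable_on zero_PiE {1..n} (\<lambda>_. UNIV)"
    by (rule has_sum_imp_summable)
  then have "(\<lambda>d. \<Prod>i=1..n. t ^ d i) summable_on increasing_diagonals n"
    by (rule summable_on_subset) (auto simp: zero_PiE_def increasing_diagonals_def)
  then show "(\<lambda>d. (\<Prod>i=1..n. t ^ d i) * B) summable_on increasing_diagonals n"
    by (rule summable_on_cmult_left)
  show "norm (t ^ (\<Sum>i=1..n. d i) * F d) \<le> (\<Prod>i=1..n. t ^ d i) * B" for d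
    using t bound[of d] by (simp add: abs_mult power_sum prod_nonneg mult_left_mono)
qed

theorem theorem8p13:
  fixes q a :: real and n :: nat and lam mu nu :: "nat \<Rightarrow> nat"
  assumes "0 < q" and "q < 1" and "n \<ge> 1" and "a \<ge> 0"
    and "partition_parts_le n lam" and "partition_parts_le n mu"
    and "nu = attached_shape n lam mu"
  shows "((\<lambda>T. q ^ rpp_size nu T * (q powr a) ^ rpp_trace n T) has_sum
     (q powr ((1 - a) * real (n choose 2)
               - real (b_stat (\<lambda>i. staircase (n + 1) i + lam i))
               - real (b_stat (\<lambda>i. staircase (n + 1) i + mu i)))
      / (\<Prod>j=1..n. qq_poch q (lam j + n - j) * qq_poch q (mu j + n - j))
      * (1 / (1 - q) ^ n)
      * simplex_q_integral q n 1
          (\<lambda>x. schur n lam x * schur n mu x * (\<Prod>i=1..n. x i powr a) * (vandermonde n x)\<^sup>2)))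
     (RPP nu)"
proof -
  note q = assms(1,2) and lam = assms(5) and mu = assms(6)
  define L where "L = (\<lambda>i. lam i + n - i)"
  define M where "M = (\<lambda>i. mu i + n - i)"
  define t where "t = q * q powr a"
  define A where "A = (\<lambda>K d. det1 n (\<lambda>i j. (q ^ (d j + (j - 1))) ^ K i))"
  define C where "C = (\<lambda>K. q ^ (\<Sum>i=1..n. (i - 1) * K i) * (\<Prod>i=1..n. qq_poch q (K i)))"
  let ?D = "increasing_diagonals n"
  let ?\<Phi> = "\<lambda>d. t ^ (\<Sum>i=1..n. d i) * (A L d / C L * (A M d / C M))"
  \<comment> \<open>Nonnegativity of \<open>a\<close> gives \<open>t \<le> q < 1\<close>, on which
    convergence over the diagonals rests.\<close>
  have "q powr a \<le> 1"
    using q \<open>a \<ge> 0\<close> by (simp add: powr_le1)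
  then have "t \<le> q"
    using q by (simp add: t_def)
  then have t: "0 < t" "t < 1"
    using q by (simp add: t_def, linarith)
  have C_pos: "0 < C K" for K
    using q unfolding C_def by (intro mult_pos_pos prod_pos ballI qq_poch_pos) auto
  have A_le: "\<bar>A K d\<bar> \<le> fact n" for K d
    unfolding A_def using q by (intro abs_det1_le) (simp add: power_le_one)
  \<comment> \<open>A sum over the diagonals alone, to which both sides will be reduced.\<close>
  define S where "S = infsum ?\<Phi> ?D"
  have "\<bar>A L d / C L * (A M d / C M)\<bar> \<le> fact n / C L * (fact n / C M)" for d
    unfolding abs_mult abs_divide using C_pos[of L] C_pos[of M] A_le[of L d] A_le[of M d]
    by (intro mult_mono divide_mono) auto
  then have \<Phi>: "(?\<Phi> has_sum S) ?D"
    unfolding S_def by (intro has_sum_infsum summable_on_increasing_diagonals[OF t])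

  \<comment> \<open>Summation over the reverse plane partitions\<close>
  have L: "L (Suc i) < L i" if "1 \<le> i" "i < n" for i
    using partition_parts_le_antimono[OF lam, of i "Suc i"] that by (simp add: L_def)
  have M: "M (Suc i) < M i" if "1 \<le> i" "i < n" for i
    using partition_parts_le_antimono[OF mu, of i "Suc i"] that by (simp add: M_def)
  have inner: "((\<lambda>p. case (d, p) of (d, U, V) \<Rightarrow>
      t ^ (\<Sum>i=1..n. d i) * (q ^ half_size n L U * q ^ half_size n M V)) has_sum ?\<Phi> d)
      (half_RPP n L d \<times> half_RPP n M d)" if "d \<in> ?D" for d
    using has_sum_cmult_right[OF has_sum_mult_Times[OF has_sum_half_RPP[where m = n and L = L, OF q L that]
          has_sum_half_RPP[where m = n and L = M, OF q M that]],
        of "t ^ (\<Sum>i=1..n. d i)"]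
    by (simp add: A_def C_def case_prod_unfold)
  have "(\<lambda>(d, U, V). t ^ (\<Sum>i=1..n. d i) * (q ^ half_size n L U * q ^ half_size n M V))
      summable_on Sigma ?D (\<lambda>d. half_RPP n L d \<times> half_RPP n M d)"
    using inner by (rule summable_on_SigmaI) (use \<Phi> q t in \<open>auto simp: summable_on_def\<close>)
  with inner \<Phi> have "((\<lambda>(d, U, V). t ^ (\<Sum>i=1..n. d i) * (q ^ half_size n L U * q ^ half_size n M V)) has_sum S)
      (Sigma ?D (\<lambda>d. half_RPP n L d \<times> half_RPP n M d))"
    by (rule has_sum_SigmaI)
  then have RPP: "((\<lambda>T. q ^ rpp_size nu T * (q powr a) ^ rpp_trace n T) has_sum S) (RPP nu)"
    unfolding assms(7) by (subst has_sum_RPP_attached_shape[OF lam mu]) (simp add: t_def L_def M_def)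

  \<comment> \<open>The integrand at the nodes of the q-integral\<close>
  let ?f = "\<lambda>x. schur n lam x * schur n mu x * (\<Prod>i=1..n. x i powr a) * (vandermonde n x)\<^sup>2"
  let ?a = "\<lambda>K x. det1 n (\<lambda>i j. x i ^ K j)"
  define G where "G = (\<lambda>u. ?f (power_point q n u) * (\<Prod>i=1..n. q ^ u i))"
  \<comment> \<open>Each Schur polynomial takes one Vandermonde factor and becomes an alternant. The
    power \<open>x i powr a\<close> and the weight \<open>q ^ u i\<close> of the node combine to
    \<open>t ^ u i\<close>.\<close>
  have G: "G u = ?a L (\<lambda>i. q ^ u i) * ?a M (\<lambda>i. q ^ u i) * t ^ (\<Sum>i=1..n. u i)" for u
  proof -
    let ?x = "power_point q n u"
    let ?V = "\<Prod>j=1..n. \<Prod>i=1..<j. ?x i - ?x j"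
    have "(\<Prod>i=1..n. ?x i powr a) * (\<Prod>i=1..n. q ^ u i) = (\<Prod>i=1..n. t ^ u i)"
      unfolding prod.distrib[symmetric]
    proof (rule prod.cong)
      fix i assume "i \<in> {1..n}"
      then show "?x i powr a * q ^ u i = t ^ u i"
        using q by (simp add: power_point_def t_def power_mult_distrib powr_power powr_powr mult.commute
            flip: powr_realpow)
    qed simp
    moreover have "?a K ?x = ?a K (\<lambda>i. q ^ u i)" for K
      by (rule det1_cong) (simp add: power_point_def)
    moreover have "?a L ?x = schur n lam ?x * ?V" "?a M ?x = schur n mu ?x * ?V"
      unfolding L_def M_def by (rule bialternant[OF lam], rule bialternant[OF mu])
    moreover have "G u = (schur n lam ?x * ?V) * (schur n mu ?x * ?V) *
        ((\<Prod>i=1..n. ?x i powr a) * (\<Prod>i=1..n. q ^ u i))"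
      unfolding G_def vandermonde_square by (simp only: power2_eq_square mult_ac)
    ultimately show ?thesis
      by (simp add: power_sum)
  qed
  have G_zero: "G u = 0" if u: "u \<in> exponent_chains n 0 - strict_chains n" for u
  proof -
    obtain i where i: "1 \<le> i" "i < n" "\<not> u (Suc i) < u i"
      using u by (auto simp: strict_chains_def)
    moreover have "u (Suc i) \<le> u i"
      using u i by (simp add: exponent_chains_def)
    ultimately have "u (Suc i) = u i"
      by simp
    with i have "power_point q n u (Suc i) - power_point q n u i = 0"
      by (simp add: power_point_def)
    with i have "(\<Prod>k=1..<Suc i. power_point q n u (Suc i) - power_point q n u k) = 0"
      by (intro prod_zero bexI[of _ i]) simp_all
    moreover have "Suc i \<in> {1..n}"
      using i by simp
    ultimately have "vandermonde n (power_point q n u) = 0"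
      unfolding vandermonde_def by (rule prod_zero[OF finite_atLeastAtMost bexI])
    then show ?thesis
      by (simp add: G_def)
  qed
  obtain s where s: "s\<^sup>2 = 1" and rev: "det1 n (\<lambda>i j. F (Suc n - i) j) = s * det1 n F" for F
    using det1_reverse_rows[of n] by blast
  \<comment> \<open>The alternants of the halves have their variables in the columns, those of the
    bialternant formula in the rows; hence a transposition in addition to the reversal.\<close>
  have A: "?a K (\<lambda>i. q ^ (if i \<in> {1..n} then d (Suc n - i) + (n - i) else 0)) = s * A K d" for K d
  proof -
    have "?a K (\<lambda>i. q ^ (if i \<in> {1..n} then d (Suc n - i) + (n - i) else 0)) =
        det1 n (\<lambda>i j. (q ^ (d (Suc n - i) + (Suc n - i - 1))) ^ K j)"
      by (rule det1_cong) simp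
    also have "\<dots> = s * det1 n (\<lambda>i j. (q ^ (d i + (i - 1))) ^ K j)"
      by (rule rev)
    finally show ?thesis
      unfolding A_def by (simp only: det1_transpose[of n "\<lambda>i j. (q ^ (d j + (j - 1))) ^ K i"])
  qed
  have sum_rev: "(\<Sum>i=1..n. if i \<in> {1..n} then d (Suc n - i) + (n - i) else 0) = (\<Sum>i=1..n. d i) + (n choose 2)" for d
  proof -
    have "(\<Sum>i=1..n. if i \<in> {1..n} then d (Suc n - i) + (n - i) else 0) = (\<Sum>i=1..n. d i + (i - 1))"
      by (rule sum.reindex_bij_witness[where i = "\<lambda>i. Suc n - i" and j = "\<lambda>i. Suc n - i"]) auto
    then show ?thesis
      by (simp only: sum.distrib sum_choose_2)
  qed
  \<comment> \<open>The power of \<open>t\<close> comes from the shifts \<open>j - 1\<close> of the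
    exponents, and the factors \<open>C L\<close> and \<open>C M\<close> clear the denominators in
    \<open>?\<Phi>\<close>.\<close>
  define c where "c = t ^ (n choose 2) * C L * C M"
  have "G (\<lambda>i. if i \<in> {1..n} then d (Suc n - i) + (n - i) else 0) = c * ?\<Phi> d" for d
  proof -
    have "G (\<lambda>i. if i \<in> {1..n} then d (Suc n - i) + (n - i) else 0) =
        s\<^sup>2 * (A L d * A M d * (t ^ (\<Sum>i=1..n. d i) * t ^ (n choose 2)))"
      unfolding G A sum_rev power_add by (simp only: power2_eq_square mult_ac)
    also have "\<dots> = c * ?\<Phi> d"
      using C_pos[of L] C_pos[of M] by (simp add: s c_def)
    finally show ?thesis .
  qed
  then have "((\<lambda>d. G (\<lambda>i. if i \<in> {1..n} then d (Suc n - i) + (n - i) else 0)) has_sum (c * S)) ?D"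
    using has_sum_cmult_right[OF \<Phi>, of c] by simp
  then have "(G has_sum (c * S)) (strict_chains n)"
    unfolding has_sum_strict_chains .
  then have "(G has_sum (c * S)) (exponent_chains n 0)"
    by (subst has_sum_cong_neutral[where T = "strict_chains n" and g = G])
       (auto simp: G_zero, auto simp: strict_chains_def)
  \<comment> \<open>The upper limit 1 is \<open>q ^ 0\<close>.\<close>
  then have simplex: "simplex_q_integral q n 1 ?f = (1 - q) ^ n * (c * S)"
    using simplex_q_integral_eq_has_sum[where f = ?f and N = 0, OF q] unfolding G_def by simp

  \<comment> \<open>Comparison of the constants\<close>
  have "t = q powr (1 + a)"
    using q by (simp add: t_def powr_add)
  then have t_choose: "t ^ (n choose 2) = q powr ((1 + a) * real (n choose 2))"
    using q by (simp add: powr_power mult.commute)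
  \<comment> \<open>The products of \<open>qq_poch\<close> cancel. The two staircases contribute
    \<open>2 * (n choose 2)\<close> to the subtracted exponents, which balances the coefficients
    \<open>1 - a\<close> and \<open>1 + a\<close>.\<close>
  have Xc: "(q powr ((1 - a) * real (n choose 2)
        - real (b_stat (\<lambda>i. staircase (n + 1) i + lam i))
        - real (b_stat (\<lambda>i. staircase (n + 1) i + mu i)))
      / (\<Prod>j=1..n. qq_poch q (lam j + n - j) * qq_poch q (mu j + n - j))) * c = 1" (is "?X * c = 1")
  proof -
    let ?P = "\<Prod>j=1..n. qq_poch q (lam j + n - j) * qq_poch q (mu j + n - j)"
    let ?l = "\<Sum>i=1..n. (i - 1) * L i" and ?m = "\<Sum>i=1..n. (i - 1) * M i"
    have "?P \<noteq> 0"
      using qq_poch_pos[OF q] by (auto simp: less_le)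
    have "c = q powr ((1 + a) * real (n choose 2) + real ?l + real ?m) * ?P"
      using q unfolding c_def C_def t_choose powr_add prod.distrib
      by (simp add: powr_realpow L_def M_def del: of_nat_sum)
    moreover have "(1 - a) * real (n choose 2) - real (?l + (n choose 2)) - real (?m + (n choose 2)) +
        ((1 + a) * real (n choose 2) + real ?l + real ?m) = 0"
      by (simp add: algebra_simps)
    ultimately show ?thesis
      using q \<open>?P \<noteq> 0\<close> unfolding b_stat_staircase[OF lam] b_stat_staircase[OF mu] L_def M_def
      by (simp add: powr_add[symmetric] del: of_nat_sum of_nat_add)
  qed
  have "S = (?X * c) * ((1 / (1 - q) ^ n) * (1 - q) ^ n) * S"
    unfolding Xc using q by simp
  also have "\<dots> = ?X * (1 / (1 - q) ^ n) * ((1 - q) ^ n * (c * S))"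
    by (simp only: mult_ac)
  finally have S_eq: "S = ?X * (1 / (1 - q) ^ n) * ((1 - q) ^ n * (c * S))" .
  show ?thesis
    unfolding simplex S_eq[symmetric] by (rule RPP)
qed

end
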